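(* For every integer $n\geq2$, \[ \dim\operatorname{span}_{\mathbb R}\{\mathbf 1_L:L\in\mathcal L_n\}=n!-(n-1)^2 \] and \[ \dim\operatorname{span}_{\mathbb R}\{\mathbf 1_L-\mathbf 1_{L'}:L,L'\in\mathcal L_n\}=n!-(n-1)^2-1 . \]
   Context: $S_n$ is the symmetric group on $[n]=\{1,\ldots,n\}$. Two permutations $\sigma,\tau\in S_n$ are disjoint if $\sigma(i)\neq\tau(i)$ for every $i\in[n]$. A one-factorization is a set $L\subseteq S_n$ of $n$ pairwise disjoint permutations; $\mathcal L_n$ is the set of all one-factorizations. $\mathbf 1_L\in\mathbb R^{S_n}$ is the indicator function of $L$. *)

theory Defs
  imports
    "HOL-Analysis.Analysis"
    "HOL-Combinatorics.Permutations"
    "HOL-Library.Function_Algebras"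
begin

text \<open>Pointwise real vector space structure on real-valued functions (the additive structure
  is the pointwise one of \<^theory>\<open>HOL-Library.Function_Algebras\<close>).\<close>

instantiation "fun" :: (type, real_vector) real_vector
begin

definition scaleR_fun :: "real \<Rightarrow> ('a \<Rightarrow> 'b) \<Rightarrow> 'a \<Rightarrow> 'b"
  where "scaleR_fun c f = (\<lambda>x. c *\<^sub>R f x)"

instance
  by standard (simp_all add: scaleR_fun_def fun_eq_iff scaleR_add_right scaleR_add_left)

end

definition sym_grp :: "nat \<Rightarrow> (nat \<Rightarrow> nat) set"
  where "sym_grp n = {\<sigma>. \<sigma> permutes {1..n}}"

definition disjoint_perms :: "nat \<Rightarrow> (nat \<Rightarrow> nat) \<Rightarrow> (nat \<Rightarrow> nat) \<Rightarrow> bool"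
  where "disjoint_perms n \<sigma> \<tau> \<longleftrightarrow> (\<forall>i\<in>{1..n}. \<sigma> i \<noteq> \<tau> i)"

definition one_factorizations :: "nat \<Rightarrow> (nat \<Rightarrow> nat) set set"
  where "one_factorizations n =
    {L. L \<subseteq> sym_grp n \<and> card L = n \<and> pairwise (disjoint_perms n) L}"

text \<open>The space of real functions on \<^term>\<open>sym_grp n\<close> is realised inside the functions on
  \<^typ>\<open>nat \<Rightarrow> nat\<close> by extension by zero, so the library's \<^const>\<open>indicator\<close> of a subset
  of \<^term>\<open>sym_grp n\<close> is its indicator function there; spans and their dimensions do not
  depend on the ambient space.\<close>

abbreviation perm_indicator :: "(nat \<Rightarrow> nat) set \<Rightarrow> (nat \<Rightarrow> nat) \<Rightarrow> real"
  where "perm_indicator L \<equiv> indicator L"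

end

theory Submission
  imports Defs
begin

text \<open>By duality, a function \<open>f\<close> on \<open>S\<^sub>n\<close> whose sums over all one-factorizations agree must be
  shown to be local, \<open>f \<sigma> = (\<Sum>i. M i (\<sigma> i))\<close>. Hall's theorem completes any two disjoint rows
  to a one-factorization, in which a row cycle can be switched. Comparing the two sums shows
  that \<open>f (\<sigma> \<circ> (i j)) - f \<sigma>\<close> is unchanged when \<open>\<sigma>\<close> is composed with a derangement of the
  positions other than \<open>i\<close> and \<open>j\<close>. For \<open>n \<noteq> 3, 5\<close> these derangements connect all
  permutations of the other positions, so the difference depends on \<open>\<sigma> i\<close> and \<open>\<sigma> j\<close> only, and the
  braid relation makes it a coboundary in the values. For \<open>n = 5\<close> this holds up to a multiple of
  the sign, whose sums over one-factorizations are not constant; for \<open>n = 3\<close> the cocycle identity is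
  itself an equality of sums over two one-factorizations.

  For the dimension, the \<open>(n - 1)\<^sup>2\<close> functions \<open>\<delta>\<^sub>\<sigma> - \<delta>\<^sub>\<tau>\<close> with \<open>\<sigma> i = a\<close>, \<open>\<sigma> n = n\<close> and
  \<open>\<tau> = \<sigma> \<circ> (i n)\<close>, for \<open>i, a < n\<close>, span a complement of the span of the indicators: the
  functionals with weights \<open>[\<sigma> i = a] - 1 / n\<close> are dual to them and vanish on the indicators,
  while a local function with zero sums that is orthogonal to them is zero.\<close>

section \<open>Completing disjoint rows to a one-factorization\<close>

text \<open>Rado's proof: if no element can be deleted from a set with at least two elements, then two
  critical subfamilies contradict submodularity of cardinality.\<close>

lemma hall_marriage:
  assumes "finite I" and "\<And>i. i \<in> I \<Longrightarrow> finite (A i)"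
    and "\<And>J. J \<subseteq> I \<Longrightarrow> card J \<le> card (\<Union>i\<in>J. A i)"
  shows "\<exists>f. inj_on f I \<and> (\<forall>i\<in>I. f i \<in> A i)"
  using assms(2,3)
proof (induction "\<Sum>i\<in>I. card (A i)" arbitrary: A rule: less_induct)
  case less
  note fin = less.prems(1) and hall = less.prems(2)
  show ?case
  proof (cases "\<forall>i\<in>I. card (A i) \<le> 1")
    case True
    have one: "card (A i) = 1" if "i \<in> I" for i
      using hall[of "{i}"] True that by force
    then have A: "A i = {the_elem (A i)}" if "i \<in> I" for i
      using that by (metis card_1_singletonE the_elem_eq)
    have "inj_on (\<lambda>i. the_elem (A i)) I"
    proof (rule inj_onI, rule ccontr)
      fix i j assume ij: "i \<in> I" "j \<in> I" "the_elem (A i) = the_elem (A j)" "i \<noteq> j"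
      then have "A i = A j" using A by metis
      then show False using hall[of "{i,j}"] ij one[of j] by simp
    qed
    then show ?thesis using A by blast
  next
    case False
    then obtain i where i: "i \<in> I" "card (A i) > 1" by force
    then obtain x y where xy: "x \<in> A i" "y \<in> A i" "x \<noteq> y"
      by (metis card_le_Suc0_iff_eq One_nat_def fin leD)
    define R where "R z = A(i := A i - {z})" for z
    have step: ?thesis if z: "z \<in> A i" and h: "\<And>J. J \<subseteq> I \<Longrightarrow> card J \<le> card (\<Union>j\<in>J. R z j)" for z
    proof -
      have "(\<Sum>j\<in>I. card (R z j)) < (\<Sum>j\<in>I. card (A j))"
        using i z fin \<open>finite I\<close>
        by (intro sum_strict_mono_ex1) (auto simp: R_def card_Diff1_le intro!: bexI[of _ i] card_Diff1_less)
      moreover have "finite (R z j)" if "j \<in> I" for j using fin that by (auto simp: R_def)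
      ultimately obtain f where "inj_on f I" "\<forall>j\<in>I. f j \<in> R z j"
        using less.hyps h by blast
      then show ?thesis by (intro exI[of _ f]) (auto simp: R_def split: if_splits)
    qed
    \<comment> \<open>Only the set at \<open>i\<close> has shrunk, so a family violating Hall's
      condition must contain \<open>i\<close>. Dropping \<open>i\<close> from it turns the strict
      inequality into a weak one.\<close>
    have crit: "\<exists>K. K \<subseteq> I - {i} \<and> card ((A i - {z}) \<union> (\<Union>j\<in>K. A j)) \<le> card K"
      if "J \<subseteq> I" "\<not> card J \<le> card (\<Union>j\<in>J. R z j)" for J z
    proof (cases "i \<in> J")
      case False
      then have "(\<Union>j\<in>J. R z j) = (\<Union>j\<in>J. A j)" by (auto simp: R_def)
      with that hall show ?thesis by auto
    next
      case True
      have fJ: "finite J" using that \<open>finite I\<close> finite_subset by blast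
      have "(\<Union>j\<in>J. R z j) = (A i - {z}) \<union> (\<Union>j\<in>J-{i}. A j)"
        using True by (auto simp: R_def split: if_splits)
      then show ?thesis
        using that True fJ by (intro exI[of _ "J - {i}"]) (auto simp: card_Diff_singleton)
    qed
    show ?thesis
    proof (rule ccontr)
      assume no: "\<not> ?thesis"
      obtain K where K: "K \<subseteq> I - {i}" "card ((A i - {x}) \<union> (\<Union>j\<in>K. A j)) \<le> card K"
        using step[OF xy(1)] crit no by metis
      obtain K' where K': "K' \<subseteq> I - {i}" "card ((A i - {y}) \<union> (\<Union>j\<in>K'. A j)) \<le> card K'"
        using step[OF xy(2)] crit no by metis
      define P where "P = (A i - {x}) \<union> (\<Union>j\<in>K. A j)"
      define Q where "Q = (A i - {y}) \<union> (\<Union>j\<in>K'. A j)"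
      have fK: "finite K" "finite K'" using K K' \<open>finite I\<close> finite_subset by blast+
      have fPQ: "finite P" "finite Q"
        using K K' fK fin i(1) by (auto simp: P_def Q_def)
      \<comment> \<open>As \<open>x \<noteq> y\<close>, the union recovers all of
        \<open>A i\<close>. This gains the extra 1 that contradicts
        \<open>card P + card Q \<le> card K + card K'\<close>.\<close>
      have "P \<union> Q = (\<Union>j\<in>insert i (K \<union> K'). A j)"
        using xy by (auto simp: P_def Q_def)
      then have "card (P \<union> Q) = card (\<Union>j\<in>insert i (K \<union> K'). A j)" by simp
      moreover have "card (insert i (K \<union> K')) \<le> card (\<Union>j\<in>insert i (K \<union> K'). A j)"
        using K K' i by (intro hall) auto
      moreover have "card (insert i (K \<union> K')) = Suc (card (K \<union> K'))"
        using fK K(1) K'(1) by (intro card_insert_disjoint) auto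
      moreover have "card (K \<inter> K') \<le> card (P \<inter> Q)"
      proof -
        have "card (K \<inter> K') \<le> card (\<Union>j\<in>K \<inter> K'. A j)" using K by (intro hall) auto
        also have "\<dots> \<le> card (P \<inter> Q)"
          using fPQ by (intro card_mono) (auto simp: P_def Q_def)
        finally show ?thesis .
      qed
      moreover have "card P + card Q = card (P \<union> Q) + card (P \<inter> Q)"
        using fPQ by (rule card_Un_Int)
      moreover have "card K + card K' = card (K \<union> K') + card (K \<inter> K')"
        using fK by (rule card_Un_Int)
      ultimately show False using K(2) K'(2) unfolding P_def Q_def by linarith
    qed
  qed
qed

section \<open>Disjoint rows as Latin rectangles and their completion\<close>

lemma sym_grp_in: "\<sigma> \<in> sym_grp n \<Longrightarrow> i \<in> {1..n} \<Longrightarrow> \<sigma> i \<in> {1..n}"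
  by (auto simp: sym_grp_def dest: permutes_in_image)

lemma sym_grp_eq_iff: "\<sigma> \<in> sym_grp n \<Longrightarrow> \<sigma> i = \<sigma> j \<longleftrightarrow> i = j"
  by (auto simp: sym_grp_def dest: permutes_inj injD)

lemma disjoint_perms_commute: "disjoint_perms n \<sigma> \<tau> \<longleftrightarrow> disjoint_perms n \<tau> \<sigma>"
  by (auto simp: disjoint_perms_def)

lemma inj_on_eval:
  assumes "pairwise (disjoint_perms n) R" "i \<in> {1..n}"
  shows "inj_on (\<lambda>\<rho>. \<rho> i) R"
  using assms unfolding inj_on_def pairwise_def disjoint_perms_def by blast

text \<open>Hall's condition follows by double counting: each position has exactly
  \<open>n - card R\<close> values left, and each value is left in at most \<open>n - card R\<close>
  positions, so the positions in \<open>J\<close> see at least \<open>card J\<close> values.\<close>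

lemma extend_row:
  assumes R: "R \<subseteq> sym_grp n" "pairwise (disjoint_perms n) R" "card R < n" and "finite R"
  shows "\<exists>\<sigma>\<in>sym_grp n. \<forall>\<rho>\<in>R. disjoint_perms n \<sigma> \<rho>"
proof -
  define A where "A i = {1..n} - (\<lambda>\<rho>. \<rho> i) ` R" for i
  have sub: "(\<lambda>\<rho>. \<rho> i) ` R \<subseteq> {1..n}" if "i \<in> {1..n}" for i
    using R(1) sym_grp_in that by blast
  have cA: "card (A i) = n - card R" if "i \<in> {1..n}" for i
    using sub[OF that] inj_on_eval[OF R(2) that] \<open>finite R\<close>
    by (simp add: A_def card_Diff_subset card_image)
  have cI: "card {i\<in>{1..n}. a \<in> A i} \<le> n - card R" if a: "a \<in> {1..n}" for a
  proof -
    have inv: "inv \<rho> a \<in> {1..n}" "\<rho> (inv \<rho> a) = a" if "\<rho> \<in> R" for \<rho>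
    proof -
      have "\<rho> permutes {1..n}" using R(1) that by (auto simp: sym_grp_def)
      then show "inv \<rho> a \<in> {1..n}" "\<rho> (inv \<rho> a) = a"
        using a by (simp_all add: permutes_in_image[OF permutes_inv] permutes_inverses
            del: atLeastAtMost_iff)
    qed
    \<comment> \<open>\<open>inv \<rho> a\<close> is the position of the value \<open>a\<close> in
      the row \<open>\<rho>\<close>; disjoint rows hold \<open>a\<close> in different
      positions.\<close>
    have "inj_on (\<lambda>\<rho>. inv \<rho> a) R"
    proof (rule inj_onI)
      fix \<rho> \<tau> assume "\<rho> \<in> R" "\<tau> \<in> R" "inv \<rho> a = inv \<tau> a"
      then show "\<rho> = \<tau>" using inv R(2) by (metis disjoint_perms_def pairwiseD)
    qed
    then have "card ((\<lambda>\<rho>. inv \<rho> a) ` R) = card R" by (rule card_image)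
    moreover have "{i\<in>{1..n}. a \<in> A i} \<subseteq> {1..n} - (\<lambda>\<rho>. inv \<rho> a) ` R"
      using inv(2) by (auto simp: A_def image_iff) metis
    then have "card {i\<in>{1..n}. a \<in> A i} \<le> card ({1..n} - (\<lambda>\<rho>. inv \<rho> a) ` R)"
      by (intro card_mono) auto
    moreover have "(\<lambda>\<rho>. inv \<rho> a) ` R \<subseteq> {1..n}" using inv by auto
    ultimately show ?thesis using \<open>finite R\<close> by (simp add: card_Diff_subset)
  qed
  have "\<exists>f. inj_on f {1..n} \<and> (\<forall>i\<in>{1..n}. f i \<in> A i)"
  proof (rule hall_marriage)
    fix J assume J: "J \<subseteq> {1..n}"
    then have fJ: "finite J" using finite_subset by blast
    let ?U = "\<Union>i\<in>J. A i"
    have fU: "finite ?U" using fJ by (auto simp: A_def)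
    have "card J * (n - card R) = (\<Sum>i\<in>J. card (A i))" using J cA by (simp add: subset_iff)
    also have "\<dots> = (\<Sum>i\<in>J. \<Sum>a\<in>?U. if a \<in> A i then 1 else 0)"
      using fU by (intro sum.cong refl) (auto simp: sum.If_cases Int_absorb1 Int_commute intro!: arg_cong[where f=card])
    also have "\<dots> = (\<Sum>a\<in>?U. \<Sum>i\<in>J. if a \<in> A i then 1 else 0)" by (rule sum.swap)
    also have "\<dots> \<le> (\<Sum>a\<in>?U. n - card R)"
    proof (rule sum_mono)
      fix a assume "a \<in> ?U"
      then have a: "a \<in> {1..n}" by (auto simp: A_def)
      have "(\<Sum>i\<in>J. if a \<in> A i then 1 else 0) = card {i\<in>J. a \<in> A i}"
        using fJ by (simp add: sum.If_cases Int_def)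
      also have "\<dots> \<le> card {i\<in>{1..n}. a \<in> A i}" using J by (intro card_mono) auto
      finally show "(\<Sum>i\<in>J. if a \<in> A i then 1 else 0) \<le> n - card R" using cI[OF a] by simp
    qed
    finally show "card J \<le> card ?U" using R(3) by simp
  qed (auto simp: A_def)
  then obtain f where f: "inj_on f {1..n}" "\<And>i. i \<in> {1..n} \<Longrightarrow> f i \<in> A i" by blast
  have "f ` {1..n} = {1..n}"
    by (rule endo_inj_surj) (use f in \<open>auto simp: A_def\<close>)
  then have "bij_betw f {1..n} {1..n}" using f by (simp add: bij_betw_def)
  \<comment> \<open>A permutation of \<open>{1..n}\<close> must fix everything outside, where Hall's
    choice function is arbitrary.\<close>
  then have "bij_betw (\<lambda>i. if i \<in> {1..n} then f i else i) {1..n} {1..n}"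
    by (rule bij_betw_cong[THEN iffD1, rotated]) simp
  then have "(\<lambda>i. if i \<in> {1..n} then f i else i) permutes {1..n}"
    by (rule bij_imp_permutes) (simp del: atLeastAtMost_iff)
  then show ?thesis
    using f by (intro bexI[of _ "\<lambda>i. if i \<in> {1..n} then f i else i"])
      (auto simp: sym_grp_def disjoint_perms_def A_def image_iff)
qed

lemma finite_sym_grp [simp]: "finite (sym_grp n)"
  by (simp add: sym_grp_def finite_permutations)

lemma extend_to_one_factorization:
  assumes "R \<subseteq> sym_grp n" "pairwise (disjoint_perms n) R" "card R \<le> n"
  shows "\<exists>L\<in>one_factorizations n. R \<subseteq> L"
  using assms
proof (induction "n - card R" arbitrary: R)
  case 0
  then show ?case by (auto simp: one_factorizations_def)
next
  case (Suc k)
  have fin: "finite R" using Suc.prems(1) finite_sym_grp finite_subset by blast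
  obtain \<sigma> where \<sigma>: "\<sigma> \<in> sym_grp n" "\<And>\<rho>. \<rho> \<in> R \<Longrightarrow> disjoint_perms n \<sigma> \<rho>"
    using extend_row[OF Suc.prems(1,2) _ fin] Suc.hyps(2) by (metis zero_less_Suc zero_less_diff)
  \<comment> \<open>\<open>Suc k = n - card R\<close> forces \<open>n > 0\<close>, so no row is
    disjoint from itself and the new row really enlarges \<open>R\<close>.\<close>
  have "\<not> disjoint_perms n \<sigma> \<sigma>" using Suc.hyps(2) by (auto simp: disjoint_perms_def)
  then have notin: "\<sigma> \<notin> R" using \<sigma> by blast
  have "\<exists>L\<in>one_factorizations n. insert \<sigma> R \<subseteq> L"
    using Suc.prems Suc.hyps(2) notin fin \<sigma>
    by (intro Suc.hyps(1)) (auto simp: pairwise_insert disjoint_perms_commute)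
  then show ?case by blast
qed

section \<open>One-factorizations as Latin squares\<close>

lemma one_factorizationsD:
  assumes "L \<in> one_factorizations n"
  shows "L \<subseteq> sym_grp n" "card L = n" "pairwise (disjoint_perms n) L" "finite L"
  using assms finite_subset[OF _ finite_sym_grp] by (auto simp: one_factorizations_def)

lemma bij_betw_eval_one_factorization:
  assumes "L \<in> one_factorizations n" "i \<in> {1..n}"
  shows "bij_betw (\<lambda>\<sigma>. \<sigma> i) L {1..n}"
proof -
  note L = one_factorizationsD[OF assms(1)]
  have "inj_on (\<lambda>\<sigma>. \<sigma> i) L" using L assms inj_on_eval by blast
  moreover from this have "(\<lambda>\<sigma>. \<sigma> i) ` L = {1..n}"
    using L assms sym_grp_in by (intro card_subset_eq) (auto simp: card_image)
  ultimately show ?thesis by (simp add: bij_betw_def)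
qed

text \<open>The easy direction of the duality: each position shows each value exactly once, so the
  sum depends on \<open>M\<close> alone.\<close>

lemma sum_one_factorization_local:
  fixes M :: "nat \<Rightarrow> nat \<Rightarrow> real"
  assumes "L \<in> one_factorizations n"
  shows "(\<Sum>\<sigma>\<in>L. \<Sum>i=1..n. M i (\<sigma> i)) = (\<Sum>i=1..n. \<Sum>a=1..n. M i a)"
proof -
  have "(\<Sum>\<sigma>\<in>L. \<Sum>i=1..n. M i (\<sigma> i)) = (\<Sum>i=1..n. \<Sum>\<sigma>\<in>L. M i (\<sigma> i))"
    by (rule sum.swap)
  also have "\<dots> = (\<Sum>i=1..n. \<Sum>a=1..n. M i a)"
    using assms by (intro sum.cong refl sum.reindex_bij_betw bij_betw_eval_one_factorization)
  finally show ?thesis .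
qed

text \<open>This reorders the columns of a Latin square. Injectivity is included for reindexing sums
  over the image.\<close>

lemma one_factorization_comp:
  assumes L: "L \<in> one_factorizations n" and \<pi>: "\<pi> \<in> sym_grp n"
  shows "(\<lambda>\<sigma>. \<sigma> \<circ> \<pi>) ` L \<in> one_factorizations n" "inj_on (\<lambda>\<sigma>. \<sigma> \<circ> \<pi>) L"
proof -
  have p: "\<pi> permutes {1..n}" using \<pi> by (simp add: sym_grp_def)
  show inj: "inj_on (\<lambda>\<sigma>. \<sigma> \<circ> \<pi>) L"
    using permutes_surj[OF p] by (auto simp: inj_on_def fun_eq_iff) (metis surjD)
  have "(\<lambda>\<sigma>. \<sigma> \<circ> \<pi>) ` L \<subseteq> sym_grp n"
    using one_factorizationsD(1)[OF L] p by (auto simp: sym_grp_def intro: permutes_compose)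
  moreover have "pairwise (disjoint_perms n) ((\<lambda>\<sigma>. \<sigma> \<circ> \<pi>) ` L)"
    unfolding pairwise_image
  proof (rule pairwiseI, rule impI)
    fix \<sigma> \<tau> assume st: "\<sigma> \<in> L" "\<tau> \<in> L" "\<sigma> \<noteq> \<tau>"
    have "disjoint_perms n \<sigma> \<tau>"
      using one_factorizationsD(3)[OF L] st by (simp add: pairwiseD)
    then show "disjoint_perms n (\<sigma> \<circ> \<pi>) (\<tau> \<circ> \<pi>)"
      using sym_grp_in[OF \<pi>] by (simp add: disjoint_perms_def)
  qed
  ultimately show "(\<lambda>\<sigma>. \<sigma> \<circ> \<pi>) ` L \<in> one_factorizations n"
    using one_factorizationsD(2)[OF L] inj by (simp add: one_factorizations_def card_image)
qed

section \<open>Switching row cycles\<close>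

abbreviation swp :: "nat \<Rightarrow> nat \<Rightarrow> nat \<Rightarrow> nat"
  where "swp \<equiv> Transposition.transpose"

definition swap_diff :: "((nat \<Rightarrow> nat) \<Rightarrow> real) \<Rightarrow> nat \<Rightarrow> nat \<Rightarrow> (nat \<Rightarrow> nat) \<Rightarrow> real"
  where "swap_diff f i j \<sigma> = f (\<sigma> \<circ> swp i j) - f \<sigma>"

lemma swap_diff_commute: "swap_diff f i j = swap_diff f j i"
  by (simp add: swap_diff_def fun_eq_iff transpose_commute)

lemma swp_in_sym_grp: "i \<in> {1..n} \<Longrightarrow> j \<in> {1..n} \<Longrightarrow> swp i j \<in> sym_grp n"
  unfolding sym_grp_def by (simp add: permutes_swap_id del: atLeastAtMost_iff)

lemma comp_in_sym_grp: "\<sigma> \<in> sym_grp n \<Longrightarrow> \<tau> \<in> sym_grp n \<Longrightarrow> \<sigma> \<circ> \<tau> \<in> sym_grp n"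
  by (simp add: sym_grp_def permutes_compose)

lemma permutes_subset_sym_grp: "\<beta> permutes B \<Longrightarrow> B \<subseteq> {1..n} \<Longrightarrow> \<beta> \<in> sym_grp n"
  by (simp add: sym_grp_def permutes_subset)

lemma comp_swp_swp [simp]: "\<sigma> \<circ> swp i j \<circ> swp i j = \<sigma>"
  by (simp add: fun_eq_iff)

lemma swp_comp_commute: "distinct [i,j,k,l] \<Longrightarrow> swp i j \<circ> swp k l = swp k l \<circ> swp i j"
  by (rule swap_id_independent) auto

text \<open>The rows \<open>\<sigma>\<close> and \<open>\<sigma> \<circ> \<beta> \<circ> swp i j\<close> are disjoint, and exchanging their entries in the
  positions \<open>i\<close> and \<open>j\<close> turns a one-factorization into another one.\<close>

lemma row_switch:
  assumes const: "\<And>L. L \<in> one_factorizations n \<Longrightarrow> sum f L = c"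
    and \<sigma>: "\<sigma> \<in> sym_grp n" and ij: "i \<in> {1..n}" "j \<in> {1..n}" "i \<noteq> j" and n: "n \<ge> 3"
    and \<beta>: "\<beta> permutes {1..n} - {i,j}" "\<And>x. x \<in> {1..n} - {i,j} \<Longrightarrow> \<beta> x \<noteq> x"
  shows "swap_diff f i j (\<sigma> \<circ> \<beta>) = swap_diff f i j \<sigma>"
proof -
  define \<tau> where "\<tau> = \<sigma> \<circ> \<beta> \<circ> swp i j"
  define \<sigma>' where "\<sigma>' = \<sigma> \<circ> swp i j"
  define \<tau>' where "\<tau>' = \<sigma> \<circ> \<beta>"
  have inS: "\<beta> \<in> sym_grp n" "\<sigma>' \<in> sym_grp n" "\<tau> \<in> sym_grp n" "\<tau>' \<in> sym_grp n"
    using permutes_subset_sym_grp[OF \<beta>(1)] \<sigma> ij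
    by (auto simp: \<tau>_def \<sigma>'_def \<tau>'_def intro!: comp_in_sym_grp swp_in_sym_grp)
  have ij_fixed: "\<beta> i = i" "\<beta> j = j" using permutes_not_in[OF \<beta>(1)] by auto
  \<comment> \<open>In every column the old and the new pair of rows hold the same two entries. This
    carries disjointness from the remaining rows over to \<open>\<sigma>'\<close> and
    \<open>\<tau>'\<close>.\<close>
  have vals: "x \<in> {i,j} \<and> \<tau> x = \<sigma>' x \<and> \<tau>' x = \<sigma> x \<and> \<sigma> x \<noteq> \<sigma>' x
      \<or> x \<notin> {i,j} \<and> \<tau> x = \<tau>' x \<and> \<sigma>' x = \<sigma> x \<and> \<tau>' x \<noteq> \<sigma> x" if "x \<in> {1..n}" for x
    using ij ij_fixed \<beta>(2)[of x] that sym_grp_eq_iff[OF \<sigma>]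
    by (cases "x = i"; cases "x = j") (auto simp: \<tau>_def \<sigma>'_def \<tau>'_def)
  have disj: "disjoint_perms n \<sigma> \<tau>" "disjoint_perms n \<sigma>' \<tau>'"
    unfolding disjoint_perms_def using vals by metis+
  have irr: "\<not> disjoint_perms n \<rho> \<rho>" for \<rho> using n by (auto simp: disjoint_perms_def)
  then have ne: "\<sigma> \<noteq> \<tau>" "\<sigma>' \<noteq> \<tau>'" using disj by metis+
  obtain L where L: "L \<in> one_factorizations n" "{\<sigma>,\<tau>} \<subseteq> L"
    using extend_to_one_factorization[of "{\<sigma>,\<tau>}" n] \<sigma> inS n disj ne
    by (auto simp: pairwise_insert disjoint_perms_commute)
  note LD = one_factorizationsD[OF L(1)]
  define L0 where "L0 = L - {\<sigma>,\<tau>}"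
  have L0: "finite L0" "L0 \<subseteq> sym_grp n" "L = insert \<sigma> (insert \<tau> L0)" "\<sigma> \<notin> L0" "\<tau> \<notin> L0"
    "pairwise (disjoint_perms n) L0"
    using L LD by (auto simp: L0_def pairwise_subset)
  have cross: "disjoint_perms n \<sigma>' \<rho>" "disjoint_perms n \<tau>' \<rho>" if "\<rho> \<in> L0" for \<rho>
  proof -
    have "disjoint_perms n \<sigma> \<rho>" "disjoint_perms n \<tau> \<rho>"
      using LD(3) L0 that by (auto simp: pairwise_insert)
    then show "disjoint_perms n \<sigma>' \<rho>" "disjoint_perms n \<tau>' \<rho>"
      unfolding disjoint_perms_def using vals by fastforce+
  qed
  then have notin: "\<sigma>' \<notin> L0" "\<tau>' \<notin> L0" using irr by blast+
  have "card (insert \<sigma>' (insert \<tau>' L0)) = card L"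
    using notin L0 ne by simp
  then have "insert \<sigma>' (insert \<tau>' L0) \<in> one_factorizations n"
    using LD(2) L0 inS cross disj
    by (auto simp: one_factorizations_def pairwise_insert disjoint_perms_commute)
  then have "sum f (insert \<sigma>' (insert \<tau>' L0)) = sum f L" using const L by simp
  then have "f \<sigma>' + f \<tau>' = f \<sigma> + f \<tau>"
    using L0 notin ne by simp
  then show ?thesis by (simp add: swap_diff_def \<sigma>'_def \<tau>'_def \<tau>_def)
qed

text \<open>The last two conditions say that \<open>swp k l \<circ> \<gamma>\<close> has no fixed
  point at \<open>l\<close> or \<open>k\<close> either, so a transposition becomes a quotient of two
  derangements. On three points the 3-cycles do not allow this, hence the bound 4.\<close>

lemma derangement_avoiding_swap:
  assumes B: "finite B" "card B \<ge> 4" and kl: "k \<in> B" "l \<in> B" "k \<noteq> (l::nat)"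
  shows "\<exists>\<gamma>. \<gamma> permutes B \<and> (\<forall>x\<in>B. \<gamma> x \<noteq> x) \<and> \<gamma> k \<noteq> l \<and> \<gamma> l \<noteq> k"
proof -
  have "card (B - {k,l}) \<ge> 2" using B kl by simp
  then obtain S where "S \<subseteq> B - {k,l}" "card S = 2" by (rule obtain_subset_with_card_n) blast
  then obtain p q where pq: "p \<in> B - {k,l}" "q \<in> B - {k,l}" "p \<noteq> q"
    by (auto simp: card_2_iff)
  have ext: "\<exists>\<gamma>. \<gamma> permutes {k,l,p,q} \<union> D \<and> (\<forall>x\<in>{k,l,p,q} \<union> D. \<gamma> x \<noteq> x) \<and> \<gamma> k \<noteq> l \<and> \<gamma> l \<noteq> k"
    if "finite D" "D \<inter> {k,l,p,q} = {}" for D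
    using that
  proof (induction D rule: finite_induct)
    case empty
    \<comment> \<open>This is the 4-cycle \<open>k\<close>, \<open>p\<close>, \<open>l\<close>,
      \<open>q\<close>, which keeps \<open>k\<close> and \<open>l\<close> apart.\<close>
    have "swp k p \<circ> swp p l \<circ> swp l q permutes {k,l,p,q}"
      by (intro permutes_compose permutes_swap_id) auto
    moreover have "(swp k p \<circ> swp p l \<circ> swp l q) k = p" "(swp k p \<circ> swp p l \<circ> swp l q) p = l"
      "(swp k p \<circ> swp p l \<circ> swp l q) l = q" "(swp k p \<circ> swp p l \<circ> swp l q) q = k"
      using pq kl by (auto simp: Transposition.transpose_def)
    ultimately show ?case
      using pq kl by (intro exI[of _ "swp k p \<circ> swp p l \<circ> swp l q"]) (auto simp del: comp_apply)
  next
    case (insert x D)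
    then obtain \<gamma> where \<gamma>: "\<gamma> permutes {k,l,p,q} \<union> D" "\<And>y. y \<in> {k,l,p,q} \<union> D \<Longrightarrow> \<gamma> y \<noteq> y"
      "\<gamma> k \<noteq> l" "\<gamma> l \<noteq> k" by auto
    have x: "\<gamma> x = x" "x \<notin> {k,l,p,q} \<union> D" using permutes_not_in[OF \<gamma>(1)] insert by auto
    have gk: "\<gamma> k \<noteq> x" using x \<gamma>(1) permutes_inj[OF \<gamma>(1)] by (metis UnCI injD insertCI)
    have "\<gamma> permutes {k,l,p,q} \<union> insert x D" using \<gamma>(1) by (rule permutes_subset) auto
    \<comment> \<open>The new point is spliced into a cycle: \<open>k\<close> now goes to
      \<open>x\<close>, and \<open>x\<close> to the old \<open>\<gamma> k\<close>.\<close>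
    then have "\<gamma> \<circ> swp x k permutes {k,l,p,q} \<union> insert x D"
      by (intro permutes_compose permutes_swap_id) auto
    moreover have "(\<gamma> \<circ> swp x k) y \<noteq> y" if "y \<in> {k,l,p,q} \<union> insert x D" for y
    proof -
      consider "y = x" | "y = k" | "y \<noteq> x" "y \<noteq> k" "y \<in> {k,l,p,q} \<union> D" using \<open>y \<in> _\<close> by auto
      then show ?thesis using x gk \<gamma>(2) by cases auto
    qed
    moreover have "(\<gamma> \<circ> swp x k) k = x" "(\<gamma> \<circ> swp x k) l = \<gamma> l" using x kl by auto
    ultimately show ?case using x \<gamma> by (intro exI[of _ "\<gamma> \<circ> swp x k"]) (auto simp del: comp_apply)
  qed
  have "{k,l,p,q} \<union> (B - {k,l,p,q}) = B" using pq kl by auto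
  then show ?thesis using ext[of "B - {k,l,p,q}"] B(1) by auto
qed

text \<open>For \<open>n = 4\<close> the swap is itself a derangement of the two other positions.
  For \<open>n \<ge> 6\<close> both \<open>\<sigma>\<close> and
  \<open>\<sigma> \<circ> swp k l\<close> are compared with
  \<open>\<sigma> \<circ> \<gamma>\<close>. For \<open>n = 5\<close> all derangements of the other
  three positions are even, so no transposition is reached.\<close>

lemma swap_diff_invariant:
  assumes const: "\<And>L. L \<in> one_factorizations n \<Longrightarrow> sum f L = c"
    and n: "n = 4 \<or> n \<ge> 6" and \<sigma>: "\<sigma> \<in> sym_grp n"
    and ijkl: "distinct [i,j,k,l]" "{i,j,k,l} \<subseteq> {1..n}"
  shows "swap_diff f i j (\<sigma> \<circ> swp k l) = swap_diff f i j \<sigma>"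
proof (cases "n = 4")
  case True
  have "card ({1..n} - {i,j}) = 2" using ijkl True by simp
  then have B: "{k,l} = {1..n} - {i,j}"
    using ijkl by (intro card_subset_eq) auto
  have "swp k l permutes {1..n} - {i,j}"
    unfolding B[symmetric] by (rule permutes_swap_id) auto
  moreover have "swp k l x \<noteq> x" if "x \<in> {1..n} - {i,j}" for x
    using that ijkl unfolding B[symmetric] by auto
  moreover have "i \<in> {1..n}" "j \<in> {1..n}" "i \<noteq> j" "3 \<le> n" using ijkl True by auto
  ultimately show ?thesis using \<sigma> by (intro row_switch[OF const]) 
next
  case False
  then have n: "n \<ge> 6" using n by simp
  let ?B = "{1..n} - {i,j}"
  have "card ?B = n - 2" using ijkl by simp
  then have "4 \<le> card ?B" "k \<in> ?B" "l \<in> ?B" "k \<noteq> l" using ijkl n by auto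
  then obtain \<gamma> where \<gamma>: "\<gamma> permutes ?B" "\<And>x. x \<in> ?B \<Longrightarrow> \<gamma> x \<noteq> x" "\<gamma> k \<noteq> l" "\<gamma> l \<noteq> k"
    using derangement_avoiding_swap[of ?B k l] by blast
  have kl: "swp k l permutes ?B" using ijkl by (intro permutes_swap_id) auto
  have ij: "i \<in> {1..n}" "j \<in> {1..n}" "i \<noteq> j" "3 \<le> n" using ijkl n by auto
  have "(swp k l \<circ> \<gamma>) x \<noteq> x" if "x \<in> ?B" for x
    using \<gamma>(2)[OF that] \<gamma>(3,4) by (auto simp: Transposition.transpose_def)
  then have "swap_diff f i j (\<sigma> \<circ> swp k l \<circ> (swp k l \<circ> \<gamma>)) = swap_diff f i j (\<sigma> \<circ> swp k l)"
    using ijkl \<sigma> permutes_compose[OF \<gamma>(1) kl]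
    by (intro row_switch[OF const _ ij] comp_in_sym_grp swp_in_sym_grp) auto
  moreover have "\<sigma> \<circ> swp k l \<circ> (swp k l \<circ> \<gamma>) = \<sigma> \<circ> \<gamma>" by (simp add: fun_eq_iff)
  moreover have "swap_diff f i j (\<sigma> \<circ> \<gamma>) = swap_diff f i j \<sigma>"
    using \<gamma> by (intro row_switch[OF const \<sigma> ij]) auto
  ultimately show ?thesis by simp
qed

lemma sym_grp_extend:
  assumes "finite J" "J \<subseteq> {1..n}" "inj_on g J" "g ` J \<subseteq> {1..n}"
  shows "\<exists>\<sigma>\<in>sym_grp n. \<forall>x\<in>J. \<sigma> x = g x"
  using assms
proof (induction J rule: finite_induct)
  case empty
  then show ?case by (auto simp: sym_grp_def intro!: exI[of _ id] permutes_id)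
next
  case (insert x J)
  then obtain \<sigma> where \<sigma>: "\<sigma> \<in> sym_grp n" "\<And>y. y \<in> J \<Longrightarrow> \<sigma> y = g y" by force
  \<comment> \<open>Correcting the value at \<open>x\<close> on the left disturbs only the values
    \<open>\<sigma> x\<close> and \<open>g x\<close>, neither of which is taken on
    \<open>J\<close>.\<close>
  have "swp (\<sigma> x) (g x) \<circ> \<sigma> \<in> sym_grp n"
    using insert \<sigma>(1) sym_grp_in[OF \<sigma>(1), of x] by (intro comp_in_sym_grp swp_in_sym_grp) auto
  moreover have "(swp (\<sigma> x) (g x) \<circ> \<sigma>) y = g y" if "y \<in> insert x J" for y
  proof (cases "y = x")
    case False
    then have "y \<in> J" using that by simp
    then have "\<sigma> y = g y" "g y \<noteq> g x"
      using False \<sigma>(2) insert.prems(2) by (auto simp: inj_on_def)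
    then show ?thesis using False sym_grp_eq_iff[OF \<sigma>(1), of y x] by simp
  qed simp
  ultimately show ?case by blast
qed

lemma sym_grp_extend2:
  assumes "i \<in> {1..n}" "j \<in> {1..n}" "i \<noteq> j" "a \<in> {1..n}" "b \<in> {1..n}" "a \<noteq> b"
  obtains \<sigma> where "\<sigma> \<in> sym_grp n" "\<sigma> i = a" "\<sigma> j = b"
  using sym_grp_extend[of "{i,j}" n "(\<lambda>_. b)(i := a)"] assms by (auto simp: inj_on_def)

lemma sym_grp_extend3:
  assumes "distinct [i,j,k]" "{i,j,k} \<subseteq> {1..n}" "distinct [a,b,c]" "{a,b,c} \<subseteq> {1..n}"
  obtains \<sigma> where "\<sigma> \<in> sym_grp n" "\<sigma> i = a" "\<sigma> j = b" "\<sigma> k = c"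
proof -
  define g where "g = (\<lambda>_. c)(i := a, j := b)"
  have g: "g i = a" "g j = b" "g k = c" using assms(1) by (auto simp: g_def)
  have "inj_on g {i,j,k}" using assms(3) by (auto simp: g)
  then show thesis
    using sym_grp_extend[of "{i,j,k}" n g] assms(2,4) that by (simp add: g) blast
qed

text \<open>Exchanging two columns gives another one-factorization, so both terms of
  \<open>swap_diff\<close> sum to \<open>c\<close>. For \<open>n = 3\<close> this replaces the
  argument with a fourth position.\<close>

lemma sum_swap_diff_one_factorization:
  assumes const: "\<And>L. L \<in> one_factorizations n \<Longrightarrow> sum f L = c"
    and L: "L \<in> one_factorizations n" and ij: "i \<in> {1..n}" "j \<in> {1..n}"
  shows "(\<Sum>\<sigma>\<in>L. swap_diff f i j \<sigma>) = 0"
proof -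
  note comp = one_factorization_comp[OF L swp_in_sym_grp[OF ij]]
  have "(\<Sum>\<sigma>\<in>L. f (\<sigma> \<circ> swp i j)) = sum f ((\<lambda>\<sigma>. \<sigma> \<circ> swp i j) ` L)"
    using comp(2) by (simp add: sum.reindex)
  then show ?thesis using const[OF comp(1)] const[OF L] by (simp add: swap_diff_def sum_subtractf)
qed

section \<open>Local functions\<close>

text \<open>The transpositions \<open>swp i n\<close> generate the symmetric group: every other
  transposition is a conjugate of one of them by another.\<close>

lemma swap_invariant_imp_constant:
  fixes g :: "(nat \<Rightarrow> nat) \<Rightarrow> real"
  assumes inv: "\<And>\<sigma> i. \<sigma> \<in> sym_grp n \<Longrightarrow> i \<in> {1..<n} \<Longrightarrow> g (\<sigma> \<circ> swp i n) = g \<sigma>"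
    and \<sigma>: "\<sigma> \<in> sym_grp n"
  shows "g \<sigma> = g id"
proof -
  have swap_n: "g (\<sigma> \<circ> swp i n) = g \<sigma>" if "\<sigma> \<in> sym_grp n" "i \<in> {1..n}" for i \<sigma>
    using inv[OF that(1), of i] that(2) by (cases "i = n") (auto simp: id_def[symmetric])
  have g_swap: "g (\<sigma> \<circ> swp i j) = g \<sigma>" if "\<sigma> \<in> sym_grp n" "i \<in> {1..n}" "j \<in> {1..n}" "i \<noteq> j" for \<sigma> i j
  proof (cases "i = n \<or> j = n")
    case True
    then show ?thesis using swap_n[OF that(1)] that by (auto simp: transpose_commute)
  next
    case False
    have n: "n \<in> {1..n}" using that by auto
    have "\<sigma> \<circ> swp i j = \<sigma> \<circ> swp i n \<circ> swp j n \<circ> swp i n"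
      using False \<open>i \<noteq> j\<close> by (auto simp: fun_eq_iff Transposition.transpose_def)
    then show ?thesis
      using that n by (simp add: swap_n comp_in_sym_grp swp_in_sym_grp del: atLeastAtMost_iff)
  qed
  have "finite {1..n}" "\<sigma> permutes {1..n}" using \<sigma> by (auto simp: sym_grp_def)
  then show ?thesis
  proof (induction rule: permutes_rev_induct)
    case (swap a b p)
    have "g (p \<circ> swp a b) = g p"
      using swap by (intro g_swap) (auto simp: sym_grp_def)
    then show ?case using swap.IH by (rule trans)
  qed simp
qed

text \<open>The first differences of \<open>f\<close> are integrated to a potential
  \<open>M\<close>. The hypothesis \<open>three\<close> supplies the cocycle identity when there is
  no fourth position to compare with.\<close>

lemma local_of_swap_diff_invariant:
  fixes f :: "(nat \<Rightarrow> nat) \<Rightarrow> real"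
  assumes n: "n \<ge> 2"
    and inv: "\<And>i j k l \<sigma>. distinct [i,j,k,l] \<Longrightarrow> {i,j,k,l} \<subseteq> {1..n} \<Longrightarrow> \<sigma> \<in> sym_grp n
      \<Longrightarrow> swap_diff f i j (\<sigma> \<circ> swp k l) = swap_diff f i j \<sigma>"
    and three: "n = 3 \<Longrightarrow> \<exists>c. \<forall>L\<in>one_factorizations n. sum f L = c"
  shows "\<exists>M. \<forall>\<sigma>\<in>sym_grp n. f \<sigma> = (\<Sum>i=1..n. M i (\<sigma> i))"
proof -
  \<comment> \<open>The two permutations differ by a permutation of the other positions, which is a
    product of swaps covered by the invariance hypothesis.\<close>
  have dep: "swap_diff f i j \<sigma> = swap_diff f i j \<tau>"
    if \<sigma>: "\<sigma> \<in> sym_grp n" and \<tau>: "\<tau> \<in> sym_grp n" and ij: "i \<in> {1..n}" "j \<in> {1..n}" "i \<noteq> j"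
      and eq: "\<sigma> i = \<tau> i" "\<sigma> j = \<tau> j" for \<sigma> \<tau> i j
  proof -
    have step: "swap_diff f i j (\<sigma> \<circ> \<pi>) = swap_diff f i j \<sigma>" if "finite ({1..n} - {i,j})" "\<pi> permutes {1..n} - {i,j}" for \<pi>
      using that
    proof (induction rule: permutes_rev_induct)
      case (swap a b p)
      have "\<sigma> \<circ> p \<in> sym_grp n"
        using \<sigma> permutes_subset_sym_grp[OF swap.hyps(4)] by (auto intro: comp_in_sym_grp)
      then have "swap_diff f i j (\<sigma> \<circ> p \<circ> swp a b) = swap_diff f i j (\<sigma> \<circ> p)"
        using ij swap.hyps(1-3) by (intro inv) auto
      then show ?case using swap.IH by (metis comp_assoc)
    qed simp
    have p: "\<sigma> permutes {1..n}" "\<tau> permutes {1..n}" using \<sigma> \<tau> by (auto simp: sym_grp_def)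
    have "inv \<sigma> \<circ> \<tau> permutes {1..n}" using p by (intro permutes_compose permutes_inv)
    then have "inv \<sigma> \<circ> \<tau> permutes {1..n} - {i,j}"
      by (rule permutes_superset) (use eq[symmetric] permutes_inverses(2)[OF p(1)] in auto)
    then have "swap_diff f i j (\<sigma> \<circ> (inv \<sigma> \<circ> \<tau>)) = swap_diff f i j \<sigma>" by (intro step) auto
    moreover have "\<sigma> \<circ> (inv \<sigma> \<circ> \<tau>) = \<tau>" using permutes_inverses(1)[OF p(1)] by (simp add: fun_eq_iff)
    ultimately show ?thesis by simp
  qed
  \<comment> \<open>By \<open>dep\<close> the choice does not matter, but it is meaningful only for
    distinct positions and distinct values; hence the side conditions on all facts about
    \<open>d\<close>.\<close>
  define d where "d i j a b = swap_diff f i j (SOME \<sigma>. \<sigma> \<in> sym_grp n \<and> \<sigma> i = a \<and> \<sigma> j = b)" for i j a b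
  have d: "swap_diff f i j \<sigma> = d i j (\<sigma> i) (\<sigma> j)"
    if "\<sigma> \<in> sym_grp n" "i \<in> {1..n}" "j \<in> {1..n}" "i \<noteq> j" for \<sigma> i j
  proof -
    define \<tau> where "\<tau> = (SOME \<tau>. \<tau> \<in> sym_grp n \<and> \<tau> i = \<sigma> i \<and> \<tau> j = \<sigma> j)"
    have "\<tau> \<in> sym_grp n \<and> \<tau> i = \<sigma> i \<and> \<tau> j = \<sigma> j"
      unfolding \<tau>_def by (rule someI[of _ \<sigma>]) (use that in simp)
    then have "swap_diff f i j \<sigma> = swap_diff f i j \<tau>" using that by (intro dep) auto
    then show ?thesis unfolding d_def \<tau>_def .
  qed
  have anti: "d i j b a = - d i j a b" and commute: "d j i b a = d i j a b"
    if ij: "i \<in> {1..n}" "j \<in> {1..n}" "i \<noteq> j" and ab: "a \<in> {1..n}" "b \<in> {1..n}" "a \<noteq> b" for i j a b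
  proof -
    obtain \<sigma> where \<sigma>: "\<sigma> \<in> sym_grp n" "\<sigma> i = a" "\<sigma> j = b"
      using sym_grp_extend2[OF ij ab] by blast
    have "\<sigma> \<circ> swp i j \<in> sym_grp n" using \<sigma> ij by (intro comp_in_sym_grp swp_in_sym_grp)
    then have "d i j b a = swap_diff f i j (\<sigma> \<circ> swp i j)"
      using d[of "\<sigma> \<circ> swp i j" i j] \<sigma> ij by simp
    also have "\<dots> = - swap_diff f i j \<sigma>" by (simp add: swap_diff_def)
    finally show "d i j b a = - d i j a b" using d[OF \<sigma>(1) ij] \<sigma> by simp
    show "d j i b a = d i j a b"
      using d[OF \<sigma>(1) ij] d[OF \<sigma>(1) ij(2,1)] ij(3) \<sigma> swap_diff_commute[of f i j] by simp
  qed
  \<comment> \<open>\<open>C i j\<close> is the failure of \<open>d i j\<close> to be a coboundary in the values. It is carried along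
    adjacent pairs \<open>i j\<close>, \<open>j k\<close> by the braid relation but negated by reversal.\<close>
  define C where "C i j a b c = d i j a b + d i j b c + d i j c a" for i j a b c
  have braid: "C i j a b c = C j k a b c"
    if ijk: "distinct [i,j,k]" "{i,j,k} \<subseteq> {1..n}" and abc: "distinct [a,b,c]" "{a,b,c} \<subseteq> {1..n}" for i j k a b c
  proof -
    obtain \<sigma> where \<sigma>: "\<sigma> \<in> sym_grp n" and v: "\<sigma> i = a" "\<sigma> j = b" "\<sigma> k = c"
      using sym_grp_extend3[OF ijk abc] by blast
    let ?s = "swp i j" and ?t = "swp j k"
    have in_n: "i \<in> {1..n}" "j \<in> {1..n}" "k \<in> {1..n}" "a \<in> {1..n}" "b \<in> {1..n}" "c \<in> {1..n}"
      using ijk abc by auto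
    have ne: "i \<noteq> j" "j \<noteq> k" "i \<noteq> k" "a \<noteq> b" "b \<noteq> c" "a \<noteq> c" using ijk abc by auto
    have st: "?s \<in> sym_grp n" "?t \<in> sym_grp n" using in_n by (auto intro!: swp_in_sym_grp)
    \<comment> \<open>Two words for \<open>swp i k\<close>: summing the differences of
      \<open>f\<close> along either path from \<open>\<sigma>\<close> gives the same total.\<close>
    have "?s \<circ> ?t \<circ> ?s = swp i k" "?t \<circ> ?s \<circ> ?t = swp i k"
      using ne transpose_comp_triple[of i k j] transpose_comp_triple[of k i j]
      by (simp_all add: transpose_commute)
    then have "\<sigma> \<circ> ?s \<circ> ?t \<circ> ?s = \<sigma> \<circ> ?t \<circ> ?s \<circ> ?t" by (simp add: comp_assoc)
    then have "swap_diff f i j \<sigma> + swap_diff f j k (\<sigma> \<circ> ?s) + swap_diff f i j (\<sigma> \<circ> ?s \<circ> ?t)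
        = swap_diff f j k \<sigma> + swap_diff f i j (\<sigma> \<circ> ?t) + swap_diff f j k (\<sigma> \<circ> ?t \<circ> ?s)"
      by (simp add: swap_diff_def)
    moreover have "swap_diff f i j \<sigma> = d i j a b" "swap_diff f j k \<sigma> = d j k b c"
      using \<sigma> in_n ne d v by auto
    moreover have "swap_diff f j k (\<sigma> \<circ> ?s) = d j k a c" "swap_diff f i j (\<sigma> \<circ> ?t) = d i j a c"
      using d[of "\<sigma> \<circ> ?s" j k] d[of "\<sigma> \<circ> ?t" i j] comp_in_sym_grp[OF \<sigma>] st in_n ne v by auto
    moreover have "swap_diff f i j (\<sigma> \<circ> ?s \<circ> ?t) = d i j b c" "swap_diff f j k (\<sigma> \<circ> ?t \<circ> ?s) = d j k a b"
      using d[of "\<sigma> \<circ> ?s \<circ> ?t" i j] d[of "\<sigma> \<circ> ?t \<circ> ?s" j k] comp_in_sym_grp \<sigma> st in_n ne v by auto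
    moreover have "d i j c a = - d i j a c" "d j k c a = - d j k a c"
      using in_n ne by (auto intro!: anti simp del: atLeastAtMost_iff)
    ultimately show ?thesis by (simp add: C_def)
  qed
  have C_commute: "C j i a b c = - C i j a b c"
    if ij: "i \<in> {1..n}" "j \<in> {1..n}" "i \<noteq> j" and abc: "distinct [a,b,c]" "{a,b,c} \<subseteq> {1..n}" for i j a b c
  proof -
    have "d j i x y = - d i j x y" if "x \<in> {1..n}" "y \<in> {1..n}" "x \<noteq> y" for x y
      using anti[OF ij that] commute[OF ij that(2,1)] that by simp
    then show ?thesis using abc by (simp add: C_def)
  qed
  have C0: "C i j a b c = 0"
    if ij: "i \<in> {1..n}" "j \<in> {1..n}" "i \<noteq> j" and abc: "distinct [a,b,c]" "{a,b,c} \<subseteq> {1..n}" for i j a b c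
  proof -
    have n3: "3 \<le> n" using card_mono[OF _ abc(2)] abc(1) by simp
    have "card ({1..n} - {i,j}) = n - 2" using ij by simp
    show ?thesis
    proof (cases "n = 3")
      case True
      obtain k where k: "{k} = {1..n} - {i,j}"
        using \<open>card _ = n - 2\<close> True card_1_singletonE[of "{1..n} - {i,j}"] by force
      then have "k \<in> {1..n} - {i,j}" by blast
      then have ijk: "distinct [i,j,k]" "{i,j,k} \<subseteq> {1..n}" "{1..n} = {i,j,k}"
        using ij k by (simp, simp, blast)
      \<comment> \<open>The cyclic Latin square of order 3: its entries in positions
        \<open>i\<close>, \<open>j\<close> are \<open>(a, b)\<close>, \<open>(b, c)\<close>,
        \<open>(c, a)\<close>, exactly the three terms of \<open>C i j a b c\<close>.\<close>
      obtain \<rho>\<^sub>1 where r1: "\<rho>\<^sub>1 \<in> sym_grp n" "\<rho>\<^sub>1 i = a" "\<rho>\<^sub>1 j = b" "\<rho>\<^sub>1 k = c"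
        using sym_grp_extend3[OF ijk(1,2) abc] by blast
      obtain \<rho>\<^sub>2 where r2: "\<rho>\<^sub>2 \<in> sym_grp n" "\<rho>\<^sub>2 i = b" "\<rho>\<^sub>2 j = c" "\<rho>\<^sub>2 k = a"
        using sym_grp_extend3[OF ijk(1,2), of b c a] abc by auto
      obtain \<rho>\<^sub>3 where r3: "\<rho>\<^sub>3 \<in> sym_grp n" "\<rho>\<^sub>3 i = c" "\<rho>\<^sub>3 j = a" "\<rho>\<^sub>3 k = b"
        using sym_grp_extend3[OF ijk(1,2), of c a b] abc by auto
      have ne: "\<rho>\<^sub>1 \<noteq> \<rho>\<^sub>2" "\<rho>\<^sub>1 \<noteq> \<rho>\<^sub>3" "\<rho>\<^sub>2 \<noteq> \<rho>\<^sub>3" using r1 r2 r3 abc by auto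
      have "disjoint_perms n \<rho>\<^sub>1 \<rho>\<^sub>2" "disjoint_perms n \<rho>\<^sub>1 \<rho>\<^sub>3" "disjoint_perms n \<rho>\<^sub>2 \<rho>\<^sub>3"
        unfolding disjoint_perms_def ijk(3) using r1 r2 r3 abc by auto
      then have "{\<rho>\<^sub>1, \<rho>\<^sub>2, \<rho>\<^sub>3} \<in> one_factorizations n"
        using r1(1) r2(1) r3(1) ne True
        by (auto simp: one_factorizations_def pairwise_insert disjoint_perms_commute)
      then have "(\<Sum>\<sigma>\<in>{\<rho>\<^sub>1, \<rho>\<^sub>2, \<rho>\<^sub>3}. swap_diff f i j \<sigma>) = 0"
        using three[OF True] sum_swap_diff_one_factorization[of n f] ij by blast
      then show ?thesis using ne d[OF r1(1) ij] d[OF r2(1) ij] d[OF r3(1) ij] r1 r2 r3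
        by (simp add: C_def)
    next
      case False
      then have "2 \<le> card ({1..n} - {i,j})" using n3 \<open>card _ = n - 2\<close> by simp
      then obtain S where "S \<subseteq> {1..n} - {i,j}" "card S = 2" by (rule obtain_subset_with_card_n) blast
      then obtain k l where kl: "k \<in> {1..n} - {i,j}" "l \<in> {1..n} - {i,j}" "k \<noteq> l"
        by (auto simp: card_2_iff)
      have ijkl: "distinct [i,j,k,l]" "{i,j,k,l} \<subseteq> {1..n}" using kl ij by simp_all
      \<comment> \<open>The adjacent pairs lead from \<open>C i j\<close> through
        \<open>C k i\<close> and \<open>C i l\<close> to \<open>C j i\<close>, so
        \<open>C i j\<close> equals its own negative.\<close>
      have "C k i a b c = C i j a b c" using ijkl by (intro braid abc) auto
      moreover have "C k i a b c = C i l a b c" using ijkl by (intro braid abc) auto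
      moreover have "C j i a b c = C i l a b c" using ijkl by (intro braid abc) auto
      moreover have "C j i a b c = - C i j a b c" using ij abc by (rule C_commute)
      ultimately show ?thesis by simp
    qed
  qed
  \<comment> \<open>The potential of \<open>d i n\<close> with base value \<open>n\<close>. The
    default 0 covers the meaningless \<open>d i n n n\<close>, and a zero row \<open>n\<close> lets
    a swap with position \<open>n\<close> change only the term at \<open>i\<close>.\<close>
  define M where "M i a = (if i = n \<or> a = n then 0 else d i n n a)" for i a
  have dM: "d i n a b = M i b - M i a" if "i \<in> {1..<n}" "a \<in> {1..n}" "b \<in> {1..n}" "a \<noteq> b" for i a b
  proof -
    have i: "i \<in> {1..n}" "n \<in> {1..n}" "i \<noteq> n" using that by auto
    consider "a = n" | "b = n" | "a \<noteq> n" "b \<noteq> n" by blast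
    then show ?thesis
    proof cases
      case 3
      then have "C i n n a b = 0" using that by (intro C0) auto
      then show ?thesis using 3 i anti[of i n n b] that by (simp add: C_def M_def)
    qed (use that i anti[of i n n a] in \<open>auto simp: M_def\<close>)
  qed
  define g where "g \<sigma> = f \<sigma> - (\<Sum>i=1..n. M i (\<sigma> i))" for \<sigma>
  have "g (\<sigma> \<circ> swp i n) = g \<sigma>" if \<sigma>: "\<sigma> \<in> sym_grp n" and i: "i \<in> {1..<n}" for \<sigma> i
  proof -
    have split: "sum h {1..n} = h i + h n + sum h ({1..n} - {i,n})" for h :: "nat \<Rightarrow> real"
    proof -
      have "{i,n} \<subseteq> {1..n}" "i \<noteq> n" using i by auto
      then show ?thesis using sum.subset_diff[of "{i,n}" "{1..n}" h] by simp
    qed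
    have v: "\<sigma> i \<in> {1..n}" "\<sigma> n \<in> {1..n}" "\<sigma> i \<noteq> \<sigma> n"
      using sym_grp_in[OF \<sigma>] sym_grp_eq_iff[OF \<sigma>] i by auto
    have "(\<Sum>j\<in>{1..n} - {i,n}. M j ((\<sigma> \<circ> swp i n) j)) = (\<Sum>j\<in>{1..n} - {i,n}. M j (\<sigma> j))"
      by (intro sum.cong) auto
    then have "(\<Sum>j=1..n. M j ((\<sigma> \<circ> swp i n) j)) - (\<Sum>j=1..n. M j (\<sigma> j))
        = M i (\<sigma> n) + M n (\<sigma> i) - M i (\<sigma> i) - M n (\<sigma> n)"
      unfolding split[of "\<lambda>j. M j ((\<sigma> \<circ> swp i n) j)"] split[of "\<lambda>j. M j (\<sigma> j)"] by simp
    moreover have "M n (\<sigma> i) = 0" "M n (\<sigma> n) = 0" by (simp_all add: M_def)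
    moreover have "swap_diff f i n \<sigma> = M i (\<sigma> n) - M i (\<sigma> i)"
      using d[OF \<sigma>, of i n] dM[OF i v] i by auto
    ultimately show ?thesis unfolding g_def swap_diff_def by linarith
  qed
  then have g: "g \<sigma> = g id" if "\<sigma> \<in> sym_grp n" for \<sigma>
    using swap_invariant_imp_constant[of n g] that by blast
  show ?thesis
  proof (intro exI ballI)
    fix \<sigma> assume "\<sigma> \<in> sym_grp n"
    then have "g \<sigma> = g id" by (rule g)
    then have "f \<sigma> = (\<Sum>i=1..n. M i (\<sigma> i)) + g id" unfolding g_def[of \<sigma>] by simp
    \<comment> \<open>The remaining constant becomes local by spreading it evenly over the
      positions.\<close>
    also have "\<dots> = (\<Sum>i=1..n. M i (\<sigma> i) + g id / n)" using n by (simp add: sum.distrib)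
    finally show "f \<sigma> = (\<Sum>i=1..n. M i (\<sigma> i) + g id / n)" .
  qed
qed

section \<open>The case of five positions\<close>

text \<open>This second difference is the obstruction to the invariance assumed in
  \<open>local_of_swap_diff_invariant\<close>.\<close>

definition mixed_diff :: "((nat \<Rightarrow> nat) \<Rightarrow> real) \<Rightarrow> nat \<Rightarrow> nat \<Rightarrow> nat \<Rightarrow> nat \<Rightarrow> (nat \<Rightarrow> nat) \<Rightarrow> real"
  where "mixed_diff f i j k l \<sigma> = swap_diff f i j (\<sigma> \<circ> swp k l) - swap_diff f i j \<sigma>"

lemma mixed_diff_swap:
  "mixed_diff f i j k l \<sigma> = mixed_diff f j i k l \<sigma>"
  "mixed_diff f i j k l \<sigma> = mixed_diff f i j l k \<sigma>"
  by (simp_all add: mixed_diff_def swap_diff_commute[of f i j] transpose_commute[of k l])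

lemma mixed_diff_commute:
  assumes "distinct [i,j,k,l]"
  shows "mixed_diff f i j k l \<sigma> = mixed_diff f k l i j \<sigma>"
  using swp_comp_commute[OF assms] by (simp add: mixed_diff_def swap_diff_def comp_assoc)

lemma mixed_diff_comp_swp:
  assumes "distinct [i,j,k,l]"
  shows "mixed_diff f i j k l (\<sigma> \<circ> swp i j) = - mixed_diff f i j k l \<sigma>"
proof -
  have "\<sigma> \<circ> swp i j \<circ> swp k l = \<sigma> \<circ> swp k l \<circ> swp i j"
    using swp_comp_commute[OF assms] by (simp add: comp_assoc)
  then show ?thesis by (simp add: mixed_diff_def swap_diff_def)
qed

text \<open>The 3-cycles on the positions other than \<open>i\<close>, \<open>j\<close> let the
  omitted index \<open>m\<close> enter the second pair. Combined with the symmetries of a second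
  difference, this yields every exchange of two of the five indices.\<close>

lemma mixed_diff_five_eq:
  assumes const: "\<And>L. L \<in> one_factorizations 5 \<Longrightarrow> sum f L = c" and \<sigma>: "\<sigma> \<in> sym_grp 5"
    and "distinct [i,j,k,l,m]" "{i,j,k,l,m} \<subseteq> {1..5}"
    and "distinct [i',j',k',l',m']" "{i',j',k',l',m'} \<subseteq> {1..5}"
  shows "mixed_diff f i j k l \<sigma> = mixed_diff f i' j' k' l' \<sigma>"
proof -
  let ?F = "\<lambda>i j k l. mixed_diff f i j k l \<sigma>"
  define ok where "ok i j k l m \<longleftrightarrow> distinct [i,j,k,l,m] \<and> {i,j,k,l,m} \<subseteq> {1..5::nat}" for i j k l m
  have last: "?F i j k l = ?F i j l m" if "ok i j k l m" for i j k l m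
  proof -
    have ne: "distinct [i,j,k,l,m]" and sub: "{i,j,k,l,m} \<subseteq> {1..5}" using that by (auto simp: ok_def)
    have "{k,l,m} \<subseteq> {1..5} - {i,j}" using ne sub by auto
    moreover have "card ({1..5} - {i,j}) = 3" "card {k,l,m} = 3" using ne sub by simp_all
    ultimately have B: "{k,l,m} = {1..5} - {i,j}" by (intro card_subset_eq) auto
    have in5: "i \<in> {1..5}" "j \<in> {1..5}" "i \<noteq> j" "(3::nat) \<le> 5" "k \<in> {1..5}" "l \<in> {1..5}" using ne sub by auto
    have "swp k l \<circ> swp l m permutes {1..5} - {i,j}"
      unfolding B[symmetric] by (intro permutes_compose permutes_swap_id) auto
    moreover have "(swp k l \<circ> swp l m) x \<noteq> x" if "x \<in> {1..5} - {i,j}" for x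
      using that ne unfolding B[symmetric] by (auto simp: Transposition.transpose_def)
    \<comment> \<open>The 3-cycle carries \<open>\<sigma> \<circ> swp k l\<close> to
      \<open>\<sigma> \<circ> swp l m\<close>.\<close>
    ultimately have "swap_diff f i j (\<sigma> \<circ> swp k l \<circ> (swp k l \<circ> swp l m)) = swap_diff f i j (\<sigma> \<circ> swp k l)"
      using in5 \<sigma> by (intro row_switch[OF const] comp_in_sym_grp swp_in_sym_grp)
    moreover have "\<sigma> \<circ> swp k l \<circ> (swp k l \<circ> swp l m) = \<sigma> \<circ> swp l m" by (simp add: fun_eq_iff)
    ultimately show ?thesis by (simp add: mixed_diff_def)
  qed
  \<comment> \<open>An index crosses between the pairs by alternately replacing one by the omitted
    index and exchanging the two pairs.\<close>
  have cross: "?F i j k l = ?F k j i l" if "ok i j k l m" for i j k l m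
  proof -
    have "?F i j k l = ?F i j l m" using that by (rule last)
    also have "\<dots> = ?F l m i j" using that by (intro mixed_diff_commute) (auto simp: ok_def)
    also have "\<dots> = ?F l m j k" using that by (intro last) (auto simp: ok_def)
    also have "\<dots> = ?F j k l m" using that by (intro mixed_diff_commute) (auto simp: ok_def)
    also have "\<dots> = ?F j k i l" using that by (intro last[symmetric]) (auto simp: ok_def)
    also have "\<dots> = ?F k j i l" by (rule mixed_diff_swap)
    finally show ?thesis .
  qed
  \<comment> \<open>The digits in these names are the two places exchanged, with 5 standing for the
    omitted index.\<close>
  have r12: "?F j i k l = ?F i j k l" and r34: "?F i j l k = ?F i j k l" for i j k l
    by (simp_all add: mixed_diff_swap[symmetric])
  have r13: "?F k j i l = ?F i j k l" if "ok i j k l m" for i j k l m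
    using cross[OF that] by simp
  have r23: "?F i k j l = ?F i j k l" if "ok i j k l m" for i j k l m
    using r13[of j i k l m] r12 that by (auto simp: ok_def)
  have r14: "?F l j k i = ?F i j k l" if "ok i j k l m" for i j k l m
    using r13[of i j l k m] r34 that by (auto simp: ok_def)
  have r24: "?F i l k j = ?F i j k l" if "ok i j k l m" for i j k l m
    using r14[of j i k l m] r12 that by (auto simp: ok_def)
  have r35: "?F i j m l = ?F i j k l" if "ok i j k l m" for i j k l m
    using last[OF that] r34 by simp
  have r45: "?F i j k m = ?F i j k l" if "ok i j k l m" for i j k l m
    using r35[of i j l k m] r34 that by (auto simp: ok_def)
  have comm: "?F i j k l = ?F k l i j" if "ok i j k l m" for i j k l m
    by (rule mixed_diff_commute) (use that in \<open>auto simp: ok_def\<close>)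
  have r15: "?F m j k l = ?F i j k l" if "ok i j k l m" for i j k l m
    using r35[of k l i j m] comm[of i j k l m] comm[of m j k l i] that by (auto simp: ok_def)
  have r25: "?F i m k l = ?F i j k l" if "ok i j k l m" for i j k l m
    using r15[of j i k l m] r12 that by (auto simp: ok_def)
  have tuple_swap: "?F (swp p q i) (swp p q j) (swp p q k) (swp p q l) = ?F i j k l"
    if ok: "ok i j k l m" and pq: "p \<in> {i,j,k,l,m}" "q \<in> {i,j,k,l,m}" "p \<noteq> q" for p q i j k l m
  proof -
    have ne: "distinct [i,j,k,l,m]" "distinct [m,l,k,j,i]" using ok by (auto simp: ok_def)
    have e: "?F j i k l = ?F i j k l" "?F i j l k = ?F i j k l"
      "?F k j i l = ?F i j k l" "?F i k j l = ?F i j k l"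
      "?F l j k i = ?F i j k l" "?F i l k j = ?F i j k l"
      "?F i j m l = ?F i j k l" "?F i j k m = ?F i j k l"
      "?F m j k l = ?F i j k l" "?F i m k l = ?F i j k l"
      by (rule r12 r34 r13[OF ok] r23[OF ok] r14[OF ok] r24[OF ok] r35[OF ok] r45[OF ok]
          r15[OF ok] r25[OF ok])+
    from pq show ?thesis
      by (elim insertE emptyE; hypsubst; simp add: Transposition.transpose_def e ne[simplified])
  qed
  \<comment> \<open>The transpositions are multiplied on the left, so each exchanges two entries of
    the current tuple as in \<open>tuple_swap\<close>.\<close>
  have perm: "?F (p i) (p j) (p k) (p l) = ?F i j k l"
    if "p permutes {1..5}" "finite {1..5::nat}" and ok: "ok i j k l m" for p
    using that(1,2)
  proof (induction rule: permutes_induct)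
    case (swap a b p)
    have "inj p" using swap.hyps(4) by (rule permutes_inj)
    moreover have "p x \<in> {1..5}" if "x \<in> {1..5}" for x
      using that permutes_in_image[OF swap.hyps(4)] by blast
    ultimately have okp: "ok (p i) (p j) (p k) (p l) (p m)"
      using ok unfolding ok_def by (simp add: inj_eq del: atLeastAtMost_iff)
    have "card {p i, p j, p k, p l, p m} = 5" using okp by (simp add: ok_def)
    then have "{p i, p j, p k, p l, p m} = {1..5}"
      using okp by (intro card_subset_eq) (auto simp: ok_def)
    then show ?case using tuple_swap[OF okp, of a b] swap.hyps(1-3) swap.IH by simp
  qed simp
  define g where "g = (\<lambda>_. m')(i := i', j := j', k := k', l := l')"
  have g: "g i = i'" "g j = j'" "g k = k'" "g l = l'" "g m = m'" using assms(3) by (auto simp: g_def)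
  have "inj_on g {i,j,k,l,m}" using assms(5) by (auto simp: g)
  then obtain p where "p \<in> sym_grp 5" "\<forall>x\<in>{i,j,k,l,m}. p x = g x"
    using sym_grp_extend[of "{i,j,k,l,m}" 5 g] assms(4,6) by (auto simp: g)
  then show ?thesis using perm[of p] assms(3,4) by (simp add: sym_grp_def ok_def g)
qed

text \<open>Since all index tuples agree, any transposition may serve as the first pair, and
  composing with it negates the value. A function negated by every transposition is a multiple of
  \<open>sign\<close>.\<close>

lemma mixed_diff_five:
  assumes const: "\<And>L. L \<in> one_factorizations 5 \<Longrightarrow> sum f L = c"
  shows "\<exists>c'. \<forall>i j k l \<sigma>. distinct [i,j,k,l] \<longrightarrow> {i,j,k,l} \<subseteq> {1..5} \<longrightarrow> \<sigma> \<in> sym_grp 5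
    \<longrightarrow> mixed_diff f i j k l \<sigma> = c' * of_int (sign \<sigma>)"
proof -
  define F where "F = mixed_diff f 1 2 3 4"
  have fifth: "\<exists>m. distinct [i,j,k,l,m] \<and> {i,j,k,l,m} \<subseteq> {1..5}"
    if "distinct [i,j,k,l]" "{i,j,k,l} \<subseteq> {1..5}" for i j k l :: nat
  proof -
    have "card ({1..5} - {i,j,k,l}) = 1" using that by (subst card_Diff_subset) auto
    then obtain m where "{m} = {1..5} - {i,j,k,l}" by (metis card_1_singletonE)
    then have "m \<in> {1..5} - {i,j,k,l}" by blast
    with that show ?thesis by (intro exI[of _ m]) auto
  qed
  have F: "mixed_diff f i j k l \<sigma> = F \<sigma>"
    if "\<sigma> \<in> sym_grp 5" "distinct [i,j,k,l]" "{i,j,k,l} \<subseteq> {1..5}" for \<sigma> i j k l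
    using fifth[OF that(2,3)] mixed_diff_five_eq[OF const that(1), of i j k l _ 1 2 3 4 5]
    by (auto simp: F_def)
  have swap: "F (\<sigma> \<circ> swp p q) = - F \<sigma>"
    if \<sigma>: "\<sigma> \<in> sym_grp 5" and pq: "p \<in> {1..5}" "q \<in> {1..5}" "p \<noteq> q" for \<sigma> p q
  proof -
    have "2 \<le> card ({1..5} - {p,q})" using pq by simp
    then obtain S where "S \<subseteq> {1..5} - {p,q}" "card S = 2" by (rule obtain_subset_with_card_n) blast
    then obtain r s where "r \<in> {1..5} - {p,q}" "s \<in> {1..5} - {p,q}" "r \<noteq> s"
      by (auto simp: card_2_iff)
    then have rs: "distinct [p,q,r,s]" "{p,q,r,s} \<subseteq> {1..5}" using pq by simp_all
    have "\<sigma> \<circ> swp p q \<in> sym_grp 5" using \<sigma> pq by (intro comp_in_sym_grp swp_in_sym_grp)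
    then show ?thesis using F[OF _ rs] mixed_diff_comp_swp[OF rs(1), of f \<sigma>] \<sigma> by metis
  qed
  have "F \<sigma> = F id * of_int (sign \<sigma>)" if "\<sigma> \<in> sym_grp 5" for \<sigma>
  proof -
    have "finite {1..5::nat}" "\<sigma> permutes {1..5}" using that by (auto simp: sym_grp_def)
    then show ?thesis
    proof (induction rule: permutes_rev_induct)
      case id
      then show ?case by (simp only: sign_id of_int_1 mult_1_right)
    next
      case (swap a b p)
      have "F (p \<circ> swp a b) = - F p"
        using swap.hyps by (intro \<open>\<And>\<sigma> p q. _ \<Longrightarrow> _ \<Longrightarrow> _ \<Longrightarrow> _ \<Longrightarrow> F (\<sigma> \<circ> swp p q) = - F \<sigma>\<close>) (auto simp: sym_grp_def)
      moreover have "sign (p \<circ> swp a b) = - sign p"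
        using swap.hyps permutes_imp_permutation[of "{1..5}" p]
        by (subst sign_compose) (auto simp: permutation_swap_id sign_swap_id)
      ultimately show ?case using swap.IH by (metis mult_minus_right of_int_minus)
    qed
  qed
  then show ?thesis using F by metis
qed

text \<open>An odd number of odd integers has an odd sum.\<close>

lemma sum_sign_one_factorization:
  assumes L: "L \<in> one_factorizations n" and n: "odd n"
  shows "(\<Sum>\<sigma>\<in>L. sign \<sigma>) \<noteq> 0"
proof -
  have "{\<sigma>\<in>L. odd (sign \<sigma>)} = L" by (auto simp: sign_def)
  then have "odd (\<Sum>\<sigma>\<in>L. sign \<sigma>)"
    using one_factorizationsD[OF L] n by (simp add: even_sum_iff)
  then show ?thesis by auto
qed

text \<open>Composing all rows with a fixed transposition negates the sum of the signs over a
  one-factorization, and that sum is odd when \<open>n\<close> is odd.\<close>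

lemma no_sign_component:
  fixes f :: "(nat \<Rightarrow> nat) \<Rightarrow> real"
  assumes const: "\<And>L. L \<in> one_factorizations n \<Longrightarrow> sum f L = c" and n: "odd n" "n \<ge> 2"
    and f: "\<And>\<sigma>. \<sigma> \<in> sym_grp n \<Longrightarrow> f \<sigma> = (\<Sum>i=1..n. M i (\<sigma> i)) + e * of_int (sign \<sigma>)"
  shows "e = 0"
proof -
  obtain L where L: "L \<in> one_factorizations n"
    using extend_to_one_factorization[of "{}" n] by auto
  have s: "swp 1 2 \<in> sym_grp n" using n by (intro swp_in_sym_grp) auto
  note comp = one_factorization_comp[OF L s]
  have sumf: "sum f L' = (\<Sum>i=1..n. \<Sum>a=1..n. M i a) + e * of_int (\<Sum>\<sigma>\<in>L'. sign \<sigma>)"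
    if "L' \<in> one_factorizations n" for L'
  proof -
    have "sum f L' = (\<Sum>\<sigma>\<in>L'. (\<Sum>i=1..n. M i (\<sigma> i)) + e * of_int (sign \<sigma>))"
      using one_factorizationsD(1)[OF that] f by (intro sum.cong) auto
    then show ?thesis
      using sum_one_factorization_local[OF that, of M] by (simp add: sum.distrib sum_distrib_left)
  qed
  have "(\<Sum>\<sigma>\<in>(\<lambda>\<sigma>. \<sigma> \<circ> swp 1 2) ` L. sign \<sigma>) = (\<Sum>\<sigma>\<in>L. sign (\<sigma> \<circ> swp 1 2))"
    using comp(2) by (simp add: sum.reindex)
  also have "\<dots> = (\<Sum>\<sigma>\<in>L. - sign \<sigma>)"
  proof (intro sum.cong refl)
    fix \<sigma> assume "\<sigma> \<in> L"
    then have "permutation \<sigma>"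
      using one_factorizationsD(1)[OF L] permutes_imp_permutation[of "{1..n}" \<sigma>] by (auto simp: sym_grp_def)
    then show "sign (\<sigma> \<circ> swp 1 2) = - sign \<sigma>"
      by (simp add: sign_compose permutation_swap_id sign_swap_id)
  qed
  finally have "(\<Sum>\<sigma>\<in>(\<lambda>\<sigma>. \<sigma> \<circ> swp 1 2) ` L. sign \<sigma>) = - (\<Sum>\<sigma>\<in>L. sign \<sigma>)" by (simp add: sum_negf)
  then have "e * of_int (- (\<Sum>\<sigma>\<in>L. sign \<sigma>)) = e * of_int (\<Sum>\<sigma>\<in>L. sign \<sigma>)"
    using sumf[OF comp(1)] sumf[OF L] const[OF comp(1)] const[OF L] by (metis add_left_cancel)
  then show ?thesis using sum_sign_one_factorization[OF L n(1)] by (simp del: of_int_sum)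
qed

text \<open>The hard direction of the duality. For \<open>n = 5\<close> a multiple of the sign is
  removed first and then shown to be zero.\<close>

lemma constant_sums_imp_local:
  fixes f :: "(nat \<Rightarrow> nat) \<Rightarrow> real"
  assumes const: "\<And>L. L \<in> one_factorizations n \<Longrightarrow> sum f L = c" and n: "n \<ge> 2"
  shows "\<exists>M. \<forall>\<sigma>\<in>sym_grp n. f \<sigma> = (\<Sum>i=1..n. M i (\<sigma> i))"
proof (cases "n = 5")
  case False
  show ?thesis
  proof (rule local_of_swap_diff_invariant[OF n])
    fix i j k l \<sigma>
    assume ijkl: "distinct [i,j,k,l]" "{i,j,k,l} \<subseteq> {1..n}" and \<sigma>: "\<sigma> \<in> sym_grp n"
    have "4 \<le> n" using card_mono[OF _ ijkl(2)] ijkl(1) by simp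
    then have "n = 4 \<or> n \<ge> 6" using False by auto
    then show "swap_diff f i j (\<sigma> \<circ> swp k l) = swap_diff f i j \<sigma>"
      using swap_diff_invariant[OF const _ \<sigma> ijkl] by blast
  qed (use const in blast)
next
  case True
  then obtain e where e: "mixed_diff f i j k l \<sigma> = e * of_int (sign \<sigma>)"
    if "distinct [i,j,k,l]" "{i,j,k,l} \<subseteq> {1..n}" "\<sigma> \<in> sym_grp n" for i j k l \<sigma>
    using mixed_diff_five[of f c] const by metis
  \<comment> \<open>The second difference of \<open>sign\<close> at \<open>\<sigma>\<close> is
    \<open>4 * sign \<sigma>\<close>, whence the factor.\<close>
  define h where "h \<sigma> = f \<sigma> - e / 4 * of_int (sign \<sigma>)" for \<sigma>
  have "\<exists>M. \<forall>\<sigma>\<in>sym_grp n. h \<sigma> = (\<Sum>i=1..n. M i (\<sigma> i))"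
  proof (rule local_of_swap_diff_invariant[OF n])
    fix i j k l \<sigma>
    assume ijkl: "distinct [i,j,k,l]" "{i,j,k,l} \<subseteq> {1..n}" and \<sigma>: "\<sigma> \<in> sym_grp n"
    have perm: "permutation \<sigma>" using \<sigma> permutes_imp_permutation[of "{1..n}" \<sigma>] by (auto simp: sym_grp_def)
    have "sign (\<sigma> \<circ> swp i j) = - sign \<sigma>" "sign (\<sigma> \<circ> swp k l) = - sign \<sigma>"
      "sign (\<sigma> \<circ> swp k l \<circ> swp i j) = sign \<sigma>"
      using perm ijkl(1) by (simp_all add: sign_compose permutation_swap_id permutation_compose sign_swap_id)
    then show "swap_diff h i j (\<sigma> \<circ> swp k l) = swap_diff h i j \<sigma>"
      using e[OF ijkl \<sigma>] by (simp add: mixed_diff_def swap_diff_def h_def)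
  qed (use True in simp)
  then obtain M where M: "\<And>\<sigma>. \<sigma> \<in> sym_grp n \<Longrightarrow> h \<sigma> = (\<Sum>i=1..n. M i (\<sigma> i))" by blast
  then have f: "f \<sigma> = (\<Sum>i=1..n. M i (\<sigma> i)) + e / 4 * of_int (sign \<sigma>)" if "\<sigma> \<in> sym_grp n" for \<sigma>
    using that unfolding h_def by (metis diff_add_cancel)
  have "e / 4 = 0" by (rule no_sign_component[OF const _ n f]) (use True in auto)
  then show ?thesis using f by auto
qed

section \<open>Dimensions\<close>

text \<open>Each \<open>\<psi> i\<close> vanishes on \<open>B\<close> and on the other
  \<open>x j\<close>, so it separates \<open>x i\<close> from their span.\<close>

lemma independent_Un_dual:
  fixes x :: "'i \<Rightarrow> 'v::real_vector" and \<psi> :: "'i \<Rightarrow> 'v \<Rightarrow> real"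
  assumes "finite I" "finite B" "independent B" "\<And>i. i \<in> I \<Longrightarrow> linear (\<psi> i)"
    and "\<And>i b. i \<in> I \<Longrightarrow> b \<in> B \<Longrightarrow> \<psi> i b = 0"
    and "\<And>i j. i \<in> I \<Longrightarrow> j \<in> I \<Longrightarrow> \<psi> i (x j) = (if i = j then 1 else 0)"
  shows "independent (B \<union> x ` I) \<and> card (B \<union> x ` I) = card B + card I"
  using assms
proof (induction I rule: finite_induct)
  case empty
  then show ?case by simp
next
  case (insert i I)
  have IH: "independent (B \<union> x ` I)" "card (B \<union> x ` I) = card B + card I"
    using insert.IH insert.prems by auto
  have "\<psi> i v = 0" if "v \<in> span (B \<union> x ` I)" for v
    using that
  proof (rule linear_eq_0_on_span[rotated 2])
    show "linear (\<psi> i)" using insert.prems by simp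
    fix v assume "v \<in> B \<union> x ` I"
    then show "\<psi> i v = 0" using insert.prems insert.hyps(2) by auto
  qed
  moreover have "\<psi> i (x i) = 1" using insert.prems(5)[of i i] by simp
  ultimately have "x i \<notin> span (B \<union> x ` I)" by (metis zero_neq_one)
  moreover from this have "x i \<notin> B \<union> x ` I" by (rule contrapos_nn) (rule span_base)
  moreover have "finite (B \<union> x ` I)" using insert.hyps(1) insert.prems(1) by simp
  moreover have "B \<union> x ` insert i I = insert (x i) (B \<union> x ` I)" by simp
  ultimately show ?case
    using IH insert.hyps by (metis independent_insertI card_insert_disjoint add_Suc_right)
qed

section \<open>Point functions and functionals given by weighted sums\<close>

definition point_fun :: "(nat \<Rightarrow> nat) \<Rightarrow> (nat \<Rightarrow> nat) \<Rightarrow> real"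
  where "point_fun \<sigma> = indicator {\<sigma>}"

lemma linear_weighted_sum:
  fixes w :: "'a \<Rightarrow> real"
  shows "linear (\<lambda>v :: 'a \<Rightarrow> real. \<Sum>s\<in>S. w s * v s)"
  by (rule linearI) (simp_all add: sum.distrib algebra_simps scaleR_fun_def sum_distrib_left)

lemma weighted_sum_point_fun:
  "finite S \<Longrightarrow> (\<Sum>s\<in>S. w s * point_fun t s) = (if t \<in> S then w t else 0)"
  by (simp add: point_fun_def indicator_def if_distrib cong: if_cong)

lemma weighted_sum_indicator:
  fixes w :: "'a \<Rightarrow> real"
  shows "finite S \<Longrightarrow> L \<subseteq> S \<Longrightarrow> (\<Sum>s\<in>S. w s * indicator L s) = sum w L"
  by (rule sum.mono_neutral_cong_right) auto

lemma indicator_eq_sum_point_fun: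
  "finite L \<Longrightarrow> (perm_indicator L :: _ \<Rightarrow> real) = (\<Sum>\<sigma>\<in>L. point_fun \<sigma>)"
proof (induction L rule: finite_induct)
  case (insert \<sigma> L)
  then have "(perm_indicator (insert \<sigma> L) :: _ \<Rightarrow> real) = point_fun \<sigma> + perm_indicator L"
    unfolding point_fun_def by (intro ext) (auto simp: indicator_def)
  with insert show ?case by simp
qed (simp add: fun_eq_iff)

lemma finite_one_factorizations: "finite (one_factorizations n)"
  by (rule finite_subset[of _ "Pow (sym_grp n)"]) (auto simp: one_factorizations_def)

lemma card_sym_grp: "card (sym_grp n) = fact n"
  unfolding sym_grp_def by (rule card_permutations) auto

text \<open>A basis of the span together with the vectors \<open>v p\<close> is shown to be a basis
  of the functions supported on \<open>sym_grp n\<close>. The additive form avoids truncated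
  subtraction.\<close>

lemma dim_span_indicators:
  assumes n: "n \<ge> 2"
  shows "dim (span {perm_indicator L | L. L \<in> one_factorizations n}) + (n - 1)\<^sup>2 = fact n"
proof -
  let ?S = "{perm_indicator L | L. L \<in> one_factorizations n} :: ((nat \<Rightarrow> nat) \<Rightarrow> real) set"
  let ?I = "{1..<n} \<times> {1..<n}"
  obtain B where B: "B \<subseteq> ?S" "independent B" "?S \<subseteq> span B" "card B = dim ?S"
    using basis_exists by blast
  have fS: "finite ?S" using finite_one_factorizations[of n] by (simp add: setcompr_eq_image)
  then have fB: "finite B" using B(1) finite_subset by blast
  have "\<exists>s. \<forall>p\<in>?I. s p \<in> sym_grp n \<and> s p (fst p) = snd p \<and> s p n = n"
  proof (rule bchoice, rule ballI)
    fix p assume "p \<in> ?I"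
    then have "fst p \<in> {1..n}" "n \<in> {1..n}" "fst p \<noteq> n" "snd p \<in> {1..n}" "n \<in> {1..n}" "snd p \<noteq> n"
      by auto
    then show "\<exists>\<sigma>. \<sigma> \<in> sym_grp n \<and> \<sigma> (fst p) = snd p \<and> \<sigma> n = n"
      by (rule sym_grp_extend2) blast
  qed
  then obtain s where s_all: "\<forall>p\<in>?I. s p \<in> sym_grp n \<and> s p (fst p) = snd p \<and> s p n = n" ..
  have s: "s p \<in> sym_grp n" "s p (fst p) = snd p" "s p n = n" if "p \<in> ?I" for p
    using bspec[OF s_all that] by blast+
  define s' where "s' p = s p \<circ> swp (fst p) n" for p
  have s': "s' p \<in> sym_grp n" if "p \<in> ?I" for p
    unfolding s'_def using s(1)[OF that] that by (intro comp_in_sym_grp swp_in_sym_grp) auto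
  define v where "v p = point_fun (s p) - point_fun (s' p)" for p
  \<comment> \<open>Exactly one of the \<open>n\<close> rows of a one-factorization has the value
    \<open>snd p\<close> at \<open>fst p\<close>; subtracting \<open>1 / n\<close> per row makes the
    total zero.\<close>
  define \<psi> where "\<psi> p w = (\<Sum>\<sigma>\<in>sym_grp n. (of_bool (\<sigma> (fst p) = snd p) - 1 / n) * w \<sigma>)"
    for p :: "nat \<times> nat" and w :: "(nat \<Rightarrow> nat) \<Rightarrow> real"
  have lin: "linear (\<psi> p)" for p unfolding \<psi>_def by (rule linear_weighted_sum)
  have \<psi>_B: "\<psi> p b = 0" if p: "p \<in> ?I" and b: "b \<in> B" for p b
  proof -
    obtain L where L: "L \<in> one_factorizations n" "b = perm_indicator L" using b B(1) by blast
    note LD = one_factorizationsD[OF L(1)]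
    have p1: "fst p \<in> {1..n}" using p by auto
    have "\<psi> p b = (\<Sum>\<sigma>\<in>L. of_bool (\<sigma> (fst p) = snd p) - 1 / n)"
      unfolding \<psi>_def L(2) using LD by (intro weighted_sum_indicator) auto
    also have "\<dots> = (\<Sum>a=1..n. of_bool (a = snd p) - 1 / n)"
      by (rule sum.reindex_bij_betw[OF bij_betw_eval_one_factorization[OF L(1) p1]])
    also have "\<dots> = 0" using p by (auto simp: sum_subtractf of_bool_def)
    finally show ?thesis .
  qed
  have \<psi>_v: "\<psi> p (v q) = (if p = q then 1 else 0)" if p: "p \<in> ?I" and q: "q \<in> ?I" for p q
  proof -
    have "\<psi> p (v q) = \<psi> p (point_fun (s q)) - \<psi> p (point_fun (s' q))"
      unfolding v_def by (rule linear_diff[OF lin])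
    also have "\<dots> = of_bool (s q (fst p) = snd p) - of_bool (s' q (fst p) = snd p)"
      using s(1)[OF q] s'[OF q] by (simp add: \<psi>_def weighted_sum_point_fun)
    \<comment> \<open>At \<open>fst q\<close> the value of \<open>s' q\<close> is \<open>n\<close>,
      which exceeds \<open>snd p\<close>. At any other \<open>fst p < n\<close> the two permutations
      agree.\<close>
    also have "\<dots> = (if p = q then 1 else 0)"
    proof (cases "fst p = fst q")
      case True
      then show ?thesis using s[OF q] p q by (auto simp: s'_def prod_eq_iff)
    next
      case False
      then show ?thesis using p by (auto simp: s'_def)
    qed
    finally show ?thesis .
  qed
  let ?X = "B \<union> v ` ?I"
  have X: "independent ?X \<and> card ?X = card B + card ?I"
    by (rule independent_Un_dual[where \<psi> = \<psi>]) (use fB B(2) lin \<psi>_B \<psi>_v in auto)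
  have P: "independent ({} \<union> point_fun ` sym_grp n) \<and>
      card ({} \<union> point_fun ` sym_grp n) = card ({} :: ((nat \<Rightarrow> nat) \<Rightarrow> real) set) + card (sym_grp n)"
  \<comment> \<open>The dual functionals are evaluations, written as one-term sums to fit
    \<open>linear_weighted_sum\<close>.\<close>
  proof (rule independent_Un_dual[where \<psi> = "\<lambda>\<sigma> w. \<Sum>\<tau>\<in>{\<sigma>}. 1 * w \<tau>"])
    show "linear (\<lambda>w :: (nat \<Rightarrow> nat) \<Rightarrow> real. \<Sum>\<tau>\<in>{\<sigma>}. 1 * w \<tau>)" for \<sigma>
      by (rule linear_weighted_sum)
  qed (auto simp: point_fun_def independent_empty)
  have "span ?X = span (point_fun ` sym_grp n)"
  proof (rule span_eq[THEN iffD2], intro conjI)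
    have pt: "point_fun \<sigma> \<in> span (point_fun ` sym_grp n)" if "\<sigma> \<in> sym_grp n" for \<sigma>
      using that by (intro span_base) auto
    show "?X \<subseteq> span (point_fun ` sym_grp n)"
    proof
      fix x assume "x \<in> ?X"
      then consider L where "L \<in> one_factorizations n" "x = perm_indicator L"
        | p where "p \<in> ?I" "x = v p" using B(1) by blast
      then show "x \<in> span (point_fun ` sym_grp n)"
      proof cases
        case (1 L)
        then show ?thesis
          using one_factorizationsD[OF 1(1)] pt
          by (auto simp: indicator_eq_sum_point_fun intro!: span_sum)
      next
        case (2 p)
        then show ?thesis unfolding v_def using pt s(1) s' by (auto intro: span_diff)
      qed
    qed
    show "point_fun ` sym_grp n \<subseteq> span ?X"
    proof (rule subsetI, rule ccontr)
      fix y assume "y \<in> point_fun ` sym_grp n" and y: "y \<notin> span ?X"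
      then obtain \<tau> where \<tau>: "\<tau> \<in> sym_grp n" "y = point_fun \<tau>" by blast
      have "independent (insert y ?X)" using X y by (intro independent_insertI) auto
      \<comment> \<open>A functional killing \<open>span ?X\<close> but not \<open>y\<close>; its
        values on point functions form an \<open>f\<close> with zero sums, which is therefore
        local.\<close>
      from linear_independent_extend[OF this, of "\<lambda>x. if x = y then 1 else (0::real)"]
      obtain \<phi> where \<phi>: "linear \<phi>" "\<forall>x\<in>insert y ?X. \<phi> x = (if x = y then 1 else (0::real))" by blast
      have "y \<notin> ?X" using y by (rule contrapos_nn) (rule span_base)
      have "\<phi> x = 0" if "x \<in> ?X" for x
      proof -
        have "x \<noteq> y" using that \<open>y \<notin> ?X\<close> by metis
        then show ?thesis using bspec[OF \<phi>(2) insertI2[OF that]] by simp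
      qed
      then have \<phi>0: "\<phi> x = 0" if "x \<in> span ?X" for x
        by (rule linear_eq_0_on_span[OF \<phi>(1) _ that])
      define f where "f \<sigma> = \<phi> (point_fun \<sigma>)" for \<sigma>
      have const: "sum f L = 0" if L: "L \<in> one_factorizations n" for L
      proof -
        have "perm_indicator L \<in> ?S" using L by blast
        with B(3) have "perm_indicator L \<in> span B" by (rule subsetD)
        moreover have "span B \<subseteq> span ?X" by (rule span_mono) simp
        ultimately have "\<phi> (perm_indicator L) = 0" using \<phi>0 by blast
        then show ?thesis
          using one_factorizationsD(4)[OF L] \<phi>(1)
          by (simp add: indicator_eq_sum_point_fun f_def linear_sum)
      qed
      obtain M where M: "\<And>\<sigma>. \<sigma> \<in> sym_grp n \<Longrightarrow> f \<sigma> = (\<Sum>i=1..n. M i (\<sigma> i))"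
        using constant_sums_imp_local[of n f 0] const n by blast
      \<comment> \<open>Vanishing on \<open>v p\<close> makes \<open>M\<close> split into a part
        depending on the position and a part depending on the value, so \<open>f\<close> is constant
        on permutations.\<close>
      have quad: "M i a = M i n + M n a - M n n" if ia: "i \<in> {1..n}" "a \<in> {1..n}" for i a
      proof (cases "i = n \<or> a = n")
        case False
        define p where "p = (i, a)"
        have p: "p \<in> ?I" "fst p = i" "snd p = a" using False ia by (auto simp: p_def)
        have "\<phi> (v p) = 0" using p by (intro \<phi>0 span_base) blast
        then have "f (s p) = f (s' p)" by (simp add: f_def v_def linear_diff[OF \<phi>(1)])
        then have eq: "(\<Sum>j=1..n. M j (s p j)) = (\<Sum>j=1..n. M j (s' p j))"
          using M s(1)[OF p(1)] s'[OF p(1)] by simp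
        have "{i,n} \<subseteq> {1..n}" "i \<noteq> n" using ia False by auto
        then have split: "sum h {1..n} = sum h ({1..n} - {i,n}) + (h i + h n)" for h :: "nat \<Rightarrow> real"
          using sum.subset_diff[of "{i,n}" "{1..n}" h] by simp
        have rest: "(\<Sum>j\<in>{1..n} - {i,n}. M j (s p j)) = (\<Sum>j\<in>{1..n} - {i,n}. M j (s' p j))"
          by (intro sum.cong) (auto simp: s'_def p)
        have "s p i = a" "s p n = n" "s' p i = n" "s' p n = a" using s[OF p(1)] p by (auto simp: s'_def)
        then show ?thesis
          using eq rest unfolding split[of "\<lambda>j. M j (s p j)"] split[of "\<lambda>j. M j (s' p j)"] by simp
      qed auto
      define K where "K = (\<Sum>i=1..n. M i n - M n n) + (\<Sum>a=1..n. M n a)"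
      have fK: "f \<sigma> = K" if \<sigma>: "\<sigma> \<in> sym_grp n" for \<sigma>
      proof -
        have "f \<sigma> = (\<Sum>i=1..n. (M i n - M n n) + M n (\<sigma> i))"
          unfolding M[OF \<sigma>]
        proof (intro sum.cong refl)
          fix i assume i: "i \<in> {1..n}"
          show "M i (\<sigma> i) = M i n - M n n + M n (\<sigma> i)"
            using quad[OF i sym_grp_in[OF \<sigma> i]] by simp
        qed
        also have "\<dots> = (\<Sum>i=1..n. M i n - M n n) + (\<Sum>i=1..n. M n (\<sigma> i))"
          by (rule sum.distrib)
        also have "(\<Sum>i=1..n. M n (\<sigma> i)) = (\<Sum>a=1..n. M n a)"
          using \<sigma> by (intro sum.reindex_bij_betw permutes_imp_bij) (simp add: sym_grp_def)
        finally show ?thesis by (simp add: K_def)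
      qed
      obtain L where L: "L \<in> one_factorizations n"
        using extend_to_one_factorization[of "{}" n] by auto
      have "sum f L = n * K" using one_factorizationsD[OF L] fK by (simp add: subset_iff)
      then have "K = 0" using const[OF L] n by simp
      then have "\<phi> y = 0" using fK[OF \<tau>(1)] \<tau>(2) by (simp add: f_def)
      then show False using \<phi>(2) by simp
    qed
  qed
  then have "card ?X = card (point_fun ` sym_grp n)"
    using X P by (metis dim_span_eq_card_independent sup_bot_left)
  then have "card B + card ?I = fact n" using X P by (simp add: card_sym_grp)
  then show ?thesis using B(4) by (simp add: power2_eq_square)
qed

text \<open>A functional equal to 1 on every indicator vanishes on the differences, so adding a
  single indicator raises the dimension by one and recovers the whole span.\<close>

lemma dim_span_indicator_differences:
  assumes n: "n \<ge> 2"
  shows "dim (span {perm_indicator L - perm_indicator L' | L L'.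
             L \<in> one_factorizations n \<and> L' \<in> one_factorizations n}) + 1
    = dim (span {perm_indicator L | L. L \<in> one_factorizations n})"
proof -
  let ?S = "{perm_indicator L | L. L \<in> one_factorizations n} :: ((nat \<Rightarrow> nat) \<Rightarrow> real) set"
  let ?D = "{perm_indicator L - perm_indicator L' | L L'.
             L \<in> one_factorizations n \<and> L' \<in> one_factorizations n} :: ((nat \<Rightarrow> nat) \<Rightarrow> real) set"
  obtain L\<^sub>0 where L0: "L\<^sub>0 \<in> one_factorizations n"
    using extend_to_one_factorization[of "{}" n] by auto
  obtain B where B: "B \<subseteq> ?D" "independent B" "?D \<subseteq> span B" "card B = dim ?D"
    using basis_exists by blast
  have "finite ?D" using finite_one_factorizations[of n] by (intro finite_image_set2) simp_all
  then have fB: "finite B" using B(1) finite_subset by blast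
  define \<psi> where "\<psi> w = (\<Sum>\<sigma>\<in>sym_grp n. 1 / n * w \<sigma>)" for w :: "(nat \<Rightarrow> nat) \<Rightarrow> real"
  have lin: "linear \<psi>" unfolding \<psi>_def by (rule linear_weighted_sum)
  have \<psi>1: "\<psi> (perm_indicator L) = 1" if "L \<in> one_factorizations n" for L
  proof -
    have "\<psi> (perm_indicator L) = (\<Sum>\<sigma>\<in>L. 1 / n)"
      unfolding \<psi>_def using one_factorizationsD[OF that] by (intro weighted_sum_indicator) auto
    then show ?thesis using one_factorizationsD[OF that] n by simp
  qed
  have \<psi>0: "\<psi> b = 0" if "b \<in> B" for b
    using that B(1) \<psi>1 linear_diff[OF lin] by auto
  have X: "independent (B \<union> perm_indicator ` {L\<^sub>0}) \<and>
      card (B \<union> perm_indicator ` {L\<^sub>0} :: ((nat \<Rightarrow> nat) \<Rightarrow> real) set) = card B + card {L\<^sub>0}"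
    by (rule independent_Un_dual[where \<psi> = "\<lambda>_. \<psi>"]) (use fB B(2) lin \<psi>0 \<psi>1 L0 in auto)
  have "span (B \<union> perm_indicator ` {L\<^sub>0}) = span ?S"
  proof (rule span_eq[THEN iffD2], intro conjI)
    have S: "perm_indicator L \<in> span ?S" if "L \<in> one_factorizations n" for L
      using that by (intro span_base) blast
    show "B \<union> perm_indicator ` {L\<^sub>0} \<subseteq> span ?S"
      using B(1) S L0 span_diff by blast
    show "?S \<subseteq> span (B \<union> perm_indicator ` {L\<^sub>0})"
    proof
      fix x assume "x \<in> ?S"
      then have "x - perm_indicator L\<^sub>0 \<in> span B" using B(3) L0 by blast
      then have "x - perm_indicator L\<^sub>0 \<in> span (B \<union> perm_indicator ` {L\<^sub>0})"
        using span_mono[of B] by blast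
      moreover have "perm_indicator L\<^sub>0 \<in> span (B \<union> perm_indicator ` {L\<^sub>0})"
        by (intro span_base) simp
      ultimately show "x \<in> span (B \<union> perm_indicator ` {L\<^sub>0})"
        using span_add by fastforce
    qed
  qed
  then have "dim (span ?S) = card (B \<union> perm_indicator ` {L\<^sub>0} :: ((nat \<Rightarrow> nat) \<Rightarrow> real) set)"
    using X by (metis dim_span_eq_card_independent)
  then show ?thesis using X B(4) by simp
qed

theorem corollary1p3:
  fixes n :: nat
  assumes "n \<ge> 2"
  shows "int (dim (span {perm_indicator L | L. L \<in> one_factorizations n}))
           = fact n - (int n - 1)\<^sup>2
       \<and> int (dim (span {perm_indicator L - perm_indicator L' | L L'.
             L \<in> one_factorizations n \<and> L' \<in> one_factorizations n}))
           = fact n - (int n - 1)\<^sup>2 - 1"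
proof -
  have "int (dim (span {perm_indicator L | L. L \<in> one_factorizations n})) + (int n - 1)\<^sup>2 = fact n"
    using arg_cong[OF dim_span_indicators[OF assms], of int] assms by (simp add: of_nat_diff)
  then show ?thesis using dim_span_indicator_differences[OF assms] by linarith
qed

end
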